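(* Let $\mathcal Z$ be separable, $k$ a bounded, continuous, characteristic kernel on $\mathcal Z$ with RKHS $\mathcal H_k$ and $\sup_{z}k(z,z)\le1$. Let $\mathcal M$ be a probability measure on $\mathcal P\times\mathcal L$ ($\mathcal P$ the Borel probability measures on $\mathcal Z$, $\mathcal L=\{-1,1\}$). Let $(P_1,l_1),\dots,(P_n,l_n)$ be i.i.d. from $\mathcal M$ and, given these, let $S_i$ be an i.i.d. sample of size $n_i$ from $P_i$, independently over $i$. Let $\mathcal F_k$ be a class of functionals $\mathcal H_k\to\mathbb{R}$ whose Lipschitz constants (w.r.t. $\|\cdot\|_{\mathcal H_k}$) are bounded by $L_{\mathcal F}$. Let $\varphi:\mathbb{R}\to\mathbb{R}_+$ be $L_\varphi$-Lipschitz with $\varphi(z)\ge\mathbb 1_{z>0}$, and $\varphi(-f(h)l)\le B$ for all $f\in\mathcal F_k$, $h\in\mathcal H_k$, $l\in\mathcal L$. Define $R_\varphi(f)=\mathbb{E}_{(P,l)\sim\mathcal M}[\varphi(-f(\mu_k(P))l)]$ and $\tilde R_\varphi(f)=\frac1n\sum_{i=1}^n\varphi(-l_if(\mu_k(P_{S_i})))$, and let $f^*\in\arg\min_{\mathcal F_k}R_\varphi$ and $\tilde f_n\in\arg\min_{\mathcal F_k}\tilde R_\varphi$ (assumed to exist, with all functions involved measurable). Then for every $\delta\in(0,1)$, with probability at least $1-\delta$ over all sources of randomness, $$R_\varphi(\tilde f_n)-R_\varphi(f^* )\le 4L_\varphi\mathfrak R_n(\mathcal F_k)+2B\sqrt{\frac{\log(2/\delta)}{2n}}+\frac{4L_\varphi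 L_{\mathcal F}}{n}\sum_{i=1}^n\Big(\sqrt{\frac{\mathbb{E}_{z\sim P_i}[k(z,z)]}{n_i}}+\sqrt{\frac{\log(2n/\delta)}{2n_i}}\Big).$$
   Context: $\mu_k(P)=\int k(z,\cdot)\,dP(z)$ is the kernel mean embedding; for a finite sample $S$, $P_S$ is its empirical distribution, so $\mu_k(P_S)=\frac1{|S|}\sum_{z\in S}k(z,\cdot)$. The Rademacher complexity is $\mathfrak R_n(\mathcal F_k)=\mathbb{E}\big[\sup_{f\in\mathcal F_k}\big|\frac1n\sum_{i=1}^n\sigma_if(\mu_k(P_i))\big|\big]$, where $\sigma_1,\dots,\sigma_n$ are i.i.d. uniform $\{-1,+1\}$ variables independent of $(P_i,l_i)\sim\mathcal M$ i.i.d. A kernel is characteristic if $P\mapsto\mu_k(P)$ is injective. *)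

theory Defs
  imports "HOL-Analysis.Analysis" "HOL-Probability.Probability"
begin

text \<open>The RKHS H_k is modelled by a Hilbert space 'h together with a feature map
  Phi : 'z => 'h such that k z z' = Phi z . Phi z' and span (range Phi) is dense.
  Then k(z,.) corresponds to Phi z and the kernel mean embedding is the Bochner integral.\<close>

definition kme :: "('z \<Rightarrow> 'h::{real_inner,complete_space,second_countable_topology}) \<Rightarrow> 'z measure \<Rightarrow> 'h" where
  "kme Phi P = integral\<^sup>L P Phi"

definition kme_emp :: "('z \<Rightarrow> 'h::{real_inner,complete_space,second_countable_topology}) \<Rightarrow> nat \<Rightarrow> (nat \<Rightarrow> 'z) \<Rightarrow> 'h" where
  "kme_emp Phi m S = (1 / real m) *\<^sub>R (\<Sum>j<m. Phi (S j))"

definition characteristic :: "('z::topological_space \<Rightarrow> 'h::{real_inner,complete_space,second_countable_topology}) \<Rightarrow> bool" where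
  "characteristic Phi \<longleftrightarrow> inj_on (kme Phi) (space (prob_algebra (borel :: 'z measure)))"

definition risk :: "(real \<Rightarrow> real) \<Rightarrow> ('z measure \<times> real) measure \<Rightarrow> ('z \<Rightarrow> 'h::{real_inner,complete_space,second_countable_topology}) \<Rightarrow> ('h \<Rightarrow> real) \<Rightarrow> real" where
  "risk \<phi> M Phi f = (\<integral>Pl. \<phi> (- f (kme Phi (fst Pl)) * snd Pl) \<partial>M)"

text \<open>Empirical risk on the two-stage sample omega = (pls, S): pls i = (P_i, l_i),
  S i j = j-th point of the i-th bag (j < ns i).\<close>
definition emp_risk :: "(real \<Rightarrow> real) \<Rightarrow> nat \<Rightarrow> (nat \<Rightarrow> nat) \<Rightarrow> ('z \<Rightarrow> 'h::{real_inner,complete_space,second_countable_topology})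
     \<Rightarrow> ((nat \<Rightarrow> 'z measure \<times> real) \<times> (nat \<Rightarrow> nat \<Rightarrow> 'z)) \<Rightarrow> ('h \<Rightarrow> real) \<Rightarrow> real" where
  "emp_risk \<phi> n ns Phi \<omega> f =
     (1 / real n) * (\<Sum>i<n. \<phi> (- snd (fst \<omega> i) * f (kme_emp Phi (ns i) (snd \<omega> i))))"

definition bag_space :: "('z measure \<times> real) measure \<Rightarrow> nat \<Rightarrow> (nat \<Rightarrow> 'z measure \<times> real) measure" where
  "bag_space M n = (\<Pi>\<^sub>M i\<in>{..<n}. M)"

definition sample_space :: "('z::topological_space measure \<times> real) measure \<Rightarrow> nat \<Rightarrow> (nat \<Rightarrow> nat)
     \<Rightarrow> ((nat \<Rightarrow> 'z measure \<times> real) \<times> (nat \<Rightarrow> nat \<Rightarrow> 'z)) measure" where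
  "sample_space M n ns =
     bag_space M n \<bind>
       (\<lambda>pls. distr (\<Pi>\<^sub>M i\<in>{..<n}. \<Pi>\<^sub>M j\<in>{..<ns i}. fst (pls i))
                   (bag_space M n \<Otimes>\<^sub>M (\<Pi>\<^sub>M i\<in>{..<n}. \<Pi>\<^sub>M j\<in>{..<ns i}. (borel :: 'z measure)))
                   (\<lambda>S. (pls, S)))"

definition rademacher_signs :: "nat \<Rightarrow> (nat \<Rightarrow> real) measure" where
  "rademacher_signs n = (\<Pi>\<^sub>M i\<in>{..<n}. measure_pmf (pmf_of_set {-1, 1::real}))"

definition rademacher_integrand ::
  "('z \<Rightarrow> 'h::{real_inner,complete_space,second_countable_topology}) \<Rightarrow> ('h \<Rightarrow> real) set \<Rightarrow> nat
     \<Rightarrow> (nat \<Rightarrow> 'z measure \<times> real) \<times> (nat \<Rightarrow> real) \<Rightarrow> ennreal" where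
  "rademacher_integrand Phi F n x =
     (SUP f\<in>F. ennreal \<bar>(1 / real n) * (\<Sum>i<n. snd x i * f (kme Phi (fst (fst x i))))\<bar>)"

definition rademacher_complexity ::
  "('z measure \<times> real) measure \<Rightarrow> ('z \<Rightarrow> 'h::{real_inner,complete_space,second_countable_topology})
     \<Rightarrow> ('h \<Rightarrow> real) set \<Rightarrow> nat \<Rightarrow> ennreal" where
  "rademacher_complexity M Phi F n =
     (\<integral>\<^sup>+ x. rademacher_integrand Phi F n x \<partial>(bag_space M n \<Otimes>\<^sub>M rademacher_signs n))"

end

theory Submission
  imports Defs
begin

text \<open>Write \<open>D f\<close> for the risk minus the empirical risk of \<open>f\<close> computed with the true embeddings of the \<open>P\<^sub>i\<close>.
  Then the excess risk is \<open>D ftil - D fstar\<close> plus a difference of empirical risks which, since \<open>ftil\<close> minimizes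
  the empirical risk with the sample embeddings, is at most \<open>2 L_phi L_F / n\<close> times the sum of the distances between
  sample and true embeddings. McDiarmid's inequality bounds each distance around its mean, and the mean by the
  variance of a sum of centered Hilbert-space vectors. Applied to \<open>sup\<^sub>f (D f - D fstar)\<close>, McDiarmid's inequality
  leaves the expectation of \<open>sup\<^sub>f D f\<close>, since \<open>D fstar\<close> has mean zero; replacing one coordinate
  at a time by a Rademacher term, this is at most \<open>2 L_phi\<close> times the Rademacher complexity. All suprema are taken over
  finite classes first and extended by monotone limits to a pointwise dense countable subclass.\<close>

text \<open>\<open>ftil\<close> depends on the sample, so whatever is said about it must hold
  uniformly over \<open>F\<close>, while \<open>fstar\<close> is fixed. Keeping
  \<open>D fstar\<close> inside the supremum lets a single use of McDiarmid's inequality control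
  both deviations: each moves by at most B/n when one bag changes, so the difference moves by at
  most 2B/n, which is the origin of the factor 2B. The failure probability is split into \<delta>/2
  for this event and \<delta>/(2n) for each of the n bags, whence log(2/\<delta>) and
  log(2n/\<delta>). Replacing one point of a bag of size m moves its embedding by up to 2/m, so
  McDiarmid's inequality adds twice the logarithmic root of the statement. Each distance is paid for
  twice, once for \<open>ftil\<close> and once for \<open>fstar\<close>; the two factors give the 4
  in front of the last sum, which is generous for its variance part. The 4 in front of the
  complexity leaves room as well, since the argument yields 2. The second stage of sampling is
  handled conditionally: once the bags are fixed, the points of one bag are i.i.d. from a fixed
  distribution, and the resulting bound is integrated over the bags.\<close>

text \<open>The library version \<open>integrableI_bounded\<close> requires the class \<open>banach\<close>, which is not implied by the sort
  \<open>{real_inner, complete_space}\<close> of the feature space.\<close>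

lemma (in prob_space) integrable_bounded_complete:
  fixes f :: "'a \<Rightarrow> 'b::{real_normed_vector, complete_space, second_countable_topology}"
  assumes f[measurable]: "f \<in> borel_measurable M"
    and bdd: "\<And>x. x \<in> space M \<Longrightarrow> norm (f x) \<le> C"
  shows "integrable M f"
proof -
  obtain s where s: "\<And>i. simple_function M (s i)"
    and lim: "\<And>x. x \<in> space M \<Longrightarrow> (\<lambda>i. s i x) \<longlonglongrightarrow> f x"
    and bound: "\<And>i x. x \<in> space M \<Longrightarrow> norm (s i x) \<le> 2 * norm (f x)"
    using borel_measurable_implies_sequence_metric[OF f, of 0] by simp metis
  have [measurable]: "s i \<in> borel_measurable M" for i
    using s by (rule borel_measurable_simple_function)
  have bd: "norm (s i x) \<le> 2 * \<bar>C\<bar>" if "x \<in> space M" for i x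
    using bound[OF that, of i] bdd[OF that] by linarith
  have fin: "(\<integral>\<^sup>+x. ennreal (2 * \<bar>C\<bar>) \<partial>M) < \<infinity>"
    by (simp add: emeasure_space_1)
  have sbi: "Bochner_Integration.simple_bochner_integrable M (s i)" for i
  proof -
    have "(\<integral>\<^sup>+x. norm (s i x) \<partial>M) \<le> (\<integral>\<^sup>+x. ennreal (2 * \<bar>C\<bar>) \<partial>M)"
      by (intro nn_integral_mono ennreal_leI bd)
    then have "(\<integral>\<^sup>+x. norm (s i x) \<partial>M) < \<infinity>" using fin by (rule le_less_trans)
    then show ?thesis by (rule simple_bochner_integrableI_bounded[OF s])
  qed
  define I where "I i = Bochner_Integration.simple_bochner_integral M (s i)" for i
  define e where "e i = (\<integral>\<^sup>+x. norm (f x - s i x) \<partial>M)" for i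
  have e: "e \<longlonglongrightarrow> 0"
    unfolding e_def
    by (rule nn_integral_dominated_convergence_norm[where w="\<lambda>_. 2 * \<bar>C\<bar>"])
       (use bd fin lim in auto)
  \<comment> \<open>The L1 errors \<open>e i\<close> control the distances between the integrals of
    the simple approximants, so metric completeness alone produces the value of the
    integral.\<close>
  have "Cauchy I"
  proof (rule metric_CauchyI)
    fix r :: real assume r: "0 < r"
    then have "eventually (\<lambda>i. e i < ennreal (r / 2)) sequentially"
      by (intro order_tendstoD(2)[OF e]) simp
    then obtain N where N: "\<And>i. N \<le> i \<Longrightarrow> e i < ennreal (r / 2)"
      by (auto simp: eventually_sequentially)
    have "dist (I i) (I j) < r" if "N \<le> i" "N \<le> j" for i j
    proof -
      have "ennreal (dist (I i) (I j)) \<le> e i + e j"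
        unfolding I_def e_def dist_norm by (intro simple_bochner_integral_bounded sbi f)
      also have "\<dots> < ennreal (r / 2) + ennreal (r / 2)"
        using that by (intro add_strict_mono N)
      also have "\<dots> = ennreal r" using r by (simp flip: ennreal_plus)
      finally show ?thesis using r by (simp add: ennreal_less_iff)
    qed
    then show "\<exists>N. \<forall>i\<ge>N. \<forall>j\<ge>N. dist (I i) (I j) < r" by blast
  qed
  then obtain y where "I \<longlonglongrightarrow> y"
    using Cauchy_convergent_iff convergent_def by blast
  then have "has_bochner_integral M f y"
    using e sbi f unfolding I_def e_def by (intro has_bochner_integral.intros)
  then show ?thesis by (rule integrable.intros)
qed

section \<open>McDiarmid's inequality\<close>

text \<open>Induction on the coordinates. Averaging out coordinate \<open>i\<close> gives a function
  \<open>g\<close> with the same bounded differences in the others; with the others fixed,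
  \<open>f - g\<close> is centered and ranges over an interval of length \<open>c i\<close>, so
  Hoeffding's lemma contributes the factor
  \<open>exp (l\<^sup>2 * (c i)\<^sup>2 / 8)\<close>.\<close>

lemma (in product_prob_space) bounded_differences_mgf:
  fixes f :: "('i \<Rightarrow> 'a) \<Rightarrow> real"
  assumes "finite J" and l: "l > 0" and "f \<in> borel_measurable (PiM J M)"
    and "\<And>x. x \<in> space (PiM J M) \<Longrightarrow> \<bar>f x\<bar> \<le> C"
    and "\<And>x i y. x \<in> space (PiM J M) \<Longrightarrow> i \<in> J \<Longrightarrow> y \<in> space (M i) \<Longrightarrow> \<bar>f (x(i := y)) - f x\<bar> \<le> c i"
  shows "(\<integral>\<^sup>+x. ennreal (exp (l * (f x - integral\<^sup>L (PiM J M) f))) \<partial>PiM J M)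
           \<le> ennreal (exp (l\<^sup>2 * (\<Sum>i\<in>J. (c i)\<^sup>2) / 8))"
  using assms(1,3-)
proof (induction J arbitrary: f rule: finite_induct)
  case empty
  show ?case
    by (simp add: PiM_empty nn_integral_count_space_finite lebesgue_integral_count_space_finite)
next
  case (insert i J)
  note [measurable] = insert.prems(1)
  interpret J: prob_space "PiM J M" by (intro prob_space_PiM prob_space)
  interpret iJ: prob_space "PiM (insert i J) M" by (intro prob_space_PiM prob_space)
  have upd: "x(i := y) \<in> space (PiM (insert i J) M)" if "x \<in> space (PiM J M)" "y \<in> space (M i)" for x y
    using that by (auto simp: space_PiM PiE_def Pi_def extensional_def)
  define g where "g x = (\<integral>y. f (x(i := y)) \<partial>M i)" for x
  have [measurable]: "(\<lambda>(x, y). f (x(i := y))) \<in> borel_measurable (PiM J M \<Otimes>\<^sub>M M i)"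
    by measurable
  have [measurable]: "g \<in> borel_measurable (PiM J M)"
    unfolding g_def by measurable
  have sec[measurable]: "(\<lambda>y. f (x(i := y))) \<in> borel_measurable (M i)" if "x \<in> space (PiM J M)" for x
    using that by measurable
  have int: "integrable (M i) (\<lambda>y. f (x(i := y)))" if "x \<in> space (PiM J M)" for x
    using that by (intro M.integrable_const_bound[where B=C] AE_I2) (auto intro!: insert.prems upd)
  have g_bdd: "\<bar>g x\<bar> \<le> C" if "x \<in> space (PiM J M)" for x
  proof -
    have "\<bar>g x\<bar> \<le> (\<integral>y. \<bar>f (x(i := y))\<bar> \<partial>M i)" unfolding g_def by (rule integral_abs_bound)
    also have "\<dots> \<le> (\<integral>y. C \<partial>M i)"
      using that by (intro integral_mono integrable_abs int) (auto intro!: insert.prems upd)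
    finally show ?thesis by (simp add: M.prob_space)
  qed
  have g_diff: "\<bar>g (x(j := z)) - g x\<bar> \<le> c j"
    if x: "x \<in> space (PiM J M)" and j: "j \<in> J" and z: "z \<in> space (M j)" for x j z
  proof -
    have x': "x(j := z) \<in> space (PiM J M)"
      using that by (auto simp: space_PiM PiE_def Pi_def extensional_def)
    have "i \<noteq> j" using j insert.hyps by auto
    then have eq: "(x(j := z))(i := y) = (x(i := y))(j := z)" for y by (rule fun_upd_twist[symmetric])
    have "\<bar>g (x(j := z)) - g x\<bar> = \<bar>\<integral>y. f ((x(j := z))(i := y)) - f (x(i := y)) \<partial>M i\<bar>"
      unfolding g_def using x x' by (simp add: int)
    also have "\<dots> \<le> (\<integral>y. \<bar>f ((x(j := z))(i := y)) - f (x(i := y))\<bar> \<partial>M i)" by (rule integral_abs_bound)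
    also have "\<dots> \<le> (\<integral>y. c j \<partial>M i)"
      using x x' j z by (intro integral_mono integrable_abs Bochner_Integration.integrable_diff int)
         (auto simp: eq intro!: insert.prems upd)
    finally show ?thesis by (simp add: M.prob_space)
  qed
  define E where "E = integral\<^sup>L (PiM (insert i J) M) f"
  have E: "E = integral\<^sup>L (PiM J M) g"
    unfolding E_def g_def
    by (rule product_integral_insert[OF insert.hyps(1,2)])
       (intro iJ.integrable_const_bound[where B=C] AE_I2, auto intro!: insert.prems)
  have hoef: "(\<integral>\<^sup>+y. ennreal (exp (l * (f (x(i := y)) - g x))) \<partial>M i) \<le> ennreal (exp (l\<^sup>2 * (c i)\<^sup>2 / 8))"
    if x: "x \<in> space (PiM J M)" for x
  proof -
    \<comment> \<open>Hoeffding's lemma sees only the length of the interval, so its left end may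
      depend on \<open>x\<close>.\<close>
    define a where "a = Inf ((\<lambda>y. f (x(i := y))) ` space (M i))"
    have ne: "space (M i) \<noteq> {}" by (rule M.not_empty)
    have "f (x(i := y)) \<in> {a..a + c i}" if y: "y \<in> space (M i)" for y
    proof -
      have "a \<le> f (x(i := y))"
        unfolding a_def
      proof (rule cInf_lower)
        show "bdd_below ((\<lambda>y. f (x(i := y))) ` space (M i))"
          by (rule bdd_belowI2[where m="-C"], drule insert.prems(2)[OF upd[OF x]], linarith)
      qed (use y in auto)
      moreover have "f (x(i := y)) - c i \<le> a"
        unfolding a_def
      proof (rule cInf_greatest)
        fix r assume "r \<in> (\<lambda>y. f (x(i := y))) ` space (M i)"
        then obtain z where z: "z \<in> space (M i)" "r = f (x(i := z))" by auto
        have "\<bar>f ((x(i := z))(i := y)) - f (x(i := z))\<bar> \<le> c i"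
          using z y x by (intro insert.prems(3) upd) auto
        then show "f (x(i := y)) - c i \<le> r" using z by simp
      qed (use ne in auto)
      ultimately show ?thesis by auto
    qed
    then interpret h: interval_bounded_random_variable "M i" "\<lambda>y. f (x(i := y))" a "a + c i"
      by unfold_locales (use x in auto)
    show ?thesis using h.Hoeffdings_lemma_nn_integral[OF l] by (simp add: g_def)
  qed
  have "(\<integral>\<^sup>+x. ennreal (exp (l * (f x - E))) \<partial>PiM (insert i J) M)
      = (\<integral>\<^sup>+x. (\<integral>\<^sup>+y. ennreal (exp (l * (f (x(i := y)) - E))) \<partial>M i) \<partial>PiM J M)"
    by (rule product_nn_integral_insert[OF insert.hyps(1,2)]) measurable
  also have "\<dots> = (\<integral>\<^sup>+x. ennreal (exp (l * (g x - E))) * (\<integral>\<^sup>+y. ennreal (exp (l * (f (x(i := y)) - g x))) \<partial>M i) \<partial>PiM J M)"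
    by (intro nn_integral_cong, subst nn_integral_cmult[symmetric])
       (auto simp: algebra_simps simp flip: ennreal_mult exp_add)
  also have "\<dots> \<le> (\<integral>\<^sup>+x. ennreal (exp (l * (g x - E))) * ennreal (exp (l\<^sup>2 * (c i)\<^sup>2 / 8)) \<partial>PiM J M)"
    by (intro nn_integral_mono mult_left_mono hoef) auto
  also have "\<dots> = (\<integral>\<^sup>+x. ennreal (exp (l * (g x - E))) \<partial>PiM J M) * ennreal (exp (l\<^sup>2 * (c i)\<^sup>2 / 8))"
    by (rule nn_integral_multc) measurable
  also have "\<dots> \<le> ennreal (exp (l\<^sup>2 * (\<Sum>i\<in>J. (c i)\<^sup>2) / 8)) * ennreal (exp (l\<^sup>2 * (c i)\<^sup>2 / 8))"
    unfolding E by (intro mult_right_mono insert.IH g_bdd g_diff) auto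
  also have "\<dots> = ennreal (exp (l\<^sup>2 * (\<Sum>i\<in>insert i J. (c i)\<^sup>2) / 8))"
    using insert.hyps by (simp add: algebra_simps add_divide_distrib flip: ennreal_mult exp_add)
  finally show ?case by (simp add: E_def)
qed

lemma (in product_prob_space) mcdiarmid:
  fixes f :: "('i \<Rightarrow> 'a) \<Rightarrow> real"
  assumes J: "finite J" and f[measurable]: "f \<in> borel_measurable (PiM J M)"
    and bdd: "\<And>x. x \<in> space (PiM J M) \<Longrightarrow> \<bar>f x\<bar> \<le> C"
    and diff: "\<And>x i y. x \<in> space (PiM J M) \<Longrightarrow> i \<in> J \<Longrightarrow> y \<in> space (M i) \<Longrightarrow> \<bar>f (x(i := y)) - f x\<bar> \<le> c i"
    and pos: "(\<Sum>i\<in>J. (c i)\<^sup>2) > 0" and t: "t > 0"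
  shows "emeasure (PiM J M) {x \<in> space (PiM J M). f x \<ge> integral\<^sup>L (PiM J M) f + t}
           \<le> ennreal (exp (- 2 * t\<^sup>2 / (\<Sum>i\<in>J. (c i)\<^sup>2)))"
proof -
  define D where "D = (\<Sum>i\<in>J. (c i)\<^sup>2)"
  define E where "E = integral\<^sup>L (PiM J M) f"
  \<comment> \<open>The minimizer of the Chernoff exponent
    \<open>- l * t + l\<^sup>2 * D / 8\<close>.\<close>
  define l where "l = 4 * t / D"
  have D: "D > 0" using pos by (simp add: D_def)
  have l: "l > 0" using D t by (simp add: l_def)
  have "emeasure (PiM J M) {x \<in> space (PiM J M). f x \<ge> E + t}
      = emeasure (PiM J M) ({x \<in> space (PiM J M). 1 \<le> ennreal (exp (- l * t)) * ennreal (exp (l * (f x - E)))})"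
    using l by (intro arg_cong[where f="emeasure _"] Collect_cong conj_cong refl)
      (auto simp: right_diff_distrib[symmetric] distrib_left[symmetric] zero_le_mult_iff
            simp flip: ennreal_mult exp_add ennreal_1)
  also have "\<dots> \<le> ennreal (exp (- l * t)) * (\<integral>\<^sup>+x. ennreal (exp (l * (f x - E))) * indicator (space (PiM J M)) x \<partial>PiM J M)"
    using nn_integral_Markov_inequality[where M="PiM J M" and A="space (PiM J M)" and c="ennreal (exp (- l * t))" and u="\<lambda>x. ennreal (exp (l * (f x - E)))"]
    by (simp add: mult_ac)
  also have "\<dots> = ennreal (exp (- l * t)) * (\<integral>\<^sup>+x. ennreal (exp (l * (f x - E))) \<partial>PiM J M)"
    by (intro arg_cong[where f="(*) _"] nn_integral_cong) auto
  also have "\<dots> \<le> ennreal (exp (- l * t)) * ennreal (exp (l\<^sup>2 * D / 8))"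
    unfolding E_def D_def by (intro mult_left_mono bounded_differences_mgf[OF J l f bdd diff]) auto
  also have "\<dots> = ennreal (exp (- 2 * t\<^sup>2 / D))"
    using D by (simp add: l_def power2_eq_square field_simps flip: ennreal_mult exp_add)
  finally show ?thesis unfolding D_def E_def .
qed

section \<open>Symmetrization and contraction\<close>

text \<open>The comparison step of the Ledoux-Talagrand contraction principle. If \<open>f\<close>
  and \<open>g\<close> attain the two maxima on the left, then \<open>u f - u g\<close> is at most
  \<open>\<bar>v f - v g\<bar>\<close>; the sign of \<open>v f - v g\<close> decides which of them
  is used as competitor in which maximum on the right.\<close>

lemma Max_add_contraction:
  fixes A u v :: "'f \<Rightarrow> real"
  assumes G: "finite G" "G \<noteq> {}"
    and uv: "\<And>f g. f \<in> G \<Longrightarrow> g \<in> G \<Longrightarrow> \<bar>u f - u g\<bar> \<le> \<bar>v f - v g\<bar>"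
  shows "Max ((\<lambda>f. A f + u f) ` G) + Max ((\<lambda>f. A f - u f) ` G)
           \<le> Max ((\<lambda>f. A f + v f) ` G) + Max ((\<lambda>f. A f - v f) ` G)"
proof -
  have "Max ((\<lambda>f. A f + u f) ` G) \<in> (\<lambda>f. A f + u f) ` G" "Max ((\<lambda>f. A f - u f) ` G) \<in> (\<lambda>f. A f - u f) ` G"
    using G by (auto intro!: Max_in)
  then obtain f g where fg: "f \<in> G" "g \<in> G"
    and M: "Max ((\<lambda>f. A f + u f) ` G) = A f + u f" "Max ((\<lambda>f. A f - u f) ` G) = A g - u g"
    by auto
  have ge: "A h + v h \<le> Max ((\<lambda>f. A f + v f) ` G)" "A h - v h \<le> Max ((\<lambda>f. A f - v f) ` G)"
    if "h \<in> G" for h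
    using that G by (auto intro!: Max_ge)
  show ?thesis
    using uv[OF fg] ge[OF fg(1)] ge[OF fg(2)] unfolding M by linarith
qed

lemma abs_Max_image_le:
  fixes h :: "'f \<Rightarrow> real"
  assumes "finite G" "G \<noteq> {}" "\<And>f. f \<in> G \<Longrightarrow> \<bar>h f\<bar> \<le> C"
  shows "\<bar>Max (h ` G)\<bar> \<le> C"
proof -
  have "Max (h ` G) \<in> h ` G" using assms by (intro Max_in) auto
  then show ?thesis using assms(3) by auto
qed

lemma Max_image_mono:
  fixes h h' :: "'f \<Rightarrow> real"
  assumes "finite G" "G \<noteq> {}" "\<And>f. f \<in> G \<Longrightarrow> h f \<le> h' f"
  shows "Max (h ` G) \<le> Max (h' ` G)"
proof -
  have "h f \<le> Max (h' ` G)" if "f \<in> G" for f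
    using assms(1) that by (intro order_trans[OF assms(3) Max_ge]) auto
  then show ?thesis using assms(1,2) by simp
qed

text \<open>Symmetrization of a single coordinate needs no ghost sample: halve \<open>A\<close>, use
  subadditivity of the maximum, and apply Jensen's inequality to the deterministic half.\<close>

lemma (in prob_space) symmetrization_contraction:
  fixes loss a :: "'f \<Rightarrow> 'a \<Rightarrow> real"
  assumes G: "finite G" "G \<noteq> {}" and L: "L \<ge> 0"
    and meas[measurable]: "\<And>f. f \<in> G \<Longrightarrow> loss f \<in> borel_measurable M" "\<And>f. f \<in> G \<Longrightarrow> a f \<in> borel_measurable M"
    and loss_bdd: "\<And>f x. f \<in> G \<Longrightarrow> x \<in> space M \<Longrightarrow> \<bar>loss f x\<bar> \<le> C"
    and a_bdd: "\<And>f x. f \<in> G \<Longrightarrow> x \<in> space M \<Longrightarrow> \<bar>a f x\<bar> \<le> C"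
    and contr: "\<And>f g x. f \<in> G \<Longrightarrow> g \<in> G \<Longrightarrow> x \<in> space M \<Longrightarrow> \<bar>loss f x - loss g x\<bar> \<le> L * \<bar>a f x - a g x\<bar>"
  shows "(\<integral>x. Max ((\<lambda>f. A f + (expectation (loss f) - loss f x)) ` G) \<partial>M)
       \<le> (\<integral>x. (Max ((\<lambda>f. A f + 2 * L * a f x) ` G) + Max ((\<lambda>f. A f - 2 * L * a f x) ` G)) / 2 \<partial>M)"
proof -
  obtain f0 where f0: "f0 \<in> G" using G by auto
  obtain x0 where x0: "x0 \<in> space M" using not_empty by auto
  have C: "C \<ge> 0" using loss_bdd[OF f0 x0] by linarith
  define K where "K = Max ((\<lambda>f. \<bar>A f\<bar>) ` G)"
  have K: "\<bar>A f\<bar> \<le> K" if "f \<in> G" for f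
    unfolding K_def using G that by (intro Max_ge) auto
  have int_loss: "integrable M (loss f)" if "f \<in> G" for f
    using that by (intro integrable_const_bound[where B=C] AE_I2) (auto intro: loss_bdd)
  have E_bdd: "\<bar>expectation (loss f)\<bar> \<le> C" if f: "f \<in> G" for f
  proof -
    have "\<bar>expectation (loss f)\<bar> \<le> (\<integral>x. \<bar>loss f x\<bar> \<partial>M)" by (rule integral_abs_bound)
    also have "\<dots> \<le> (\<integral>x. C \<partial>M)" using f by (intro integral_mono integrable_abs int_loss loss_bdd) auto
    finally show ?thesis by (simp add: prob_space)
  qed
  have int_Max: "integrable M (\<lambda>x. Max ((\<lambda>f. h f x) ` G))"
    if [measurable]: "\<And>f. f \<in> G \<Longrightarrow> h f \<in> borel_measurable M"
      and "\<And>f x. f \<in> G \<Longrightarrow> x \<in> space M \<Longrightarrow> \<bar>h f x\<bar> \<le> D" for h :: "'f \<Rightarrow> 'a \<Rightarrow> real" and D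
  proof (rule integrable_const_bound[where B=D])
    show "AE x in M. norm (Max ((\<lambda>f. h f x) ` G)) \<le> D"
      using that G by (intro AE_I2) (auto intro!: abs_Max_image_le)
  qed (use G in measurable)
  have La: "\<bar>2 * L * a f x\<bar> \<le> 2 * (L * C)" if "f \<in> G" "x \<in> space M" for f x
    using a_bdd[OF that] L by (simp add: abs_mult mult_left_mono)
  have i1: "integrable M (\<lambda>x. Max ((\<lambda>f. A f + (expectation (loss f) - loss f x)) ` G))"
    by (rule int_Max[of _ "K + 2 * C"]) (auto, smt (verit) K E_bdd loss_bdd)
  have i2: "integrable M (\<lambda>x. Max ((\<lambda>f. A f + 2 * loss f x) ` G))"
    by (rule int_Max[of _ "K + 2 * C"]) (auto, smt (verit) K loss_bdd)
  have i3: "integrable M (\<lambda>x. Max ((\<lambda>f. A f - 2 * loss f x) ` G))"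
    by (rule int_Max[of _ "K + 2 * C"]) (auto, smt (verit) K loss_bdd)
  have i4: "integrable M (\<lambda>x. Max ((\<lambda>f. A f + 2 * L * a f x) ` G))"
    by (rule int_Max[of _ "K + 2 * (L * C)"]) (auto, smt (verit) K La)
  have i5: "integrable M (\<lambda>x. Max ((\<lambda>f. A f - 2 * L * a f x) ` G))"
    by (rule int_Max[of _ "K + 2 * (L * C)"]) (auto, smt (verit) K La)
  define J where "J = Max ((\<lambda>f. A f + 2 * expectation (loss f)) ` G)"
  have jensen: "J \<le> (\<integral>x. Max ((\<lambda>f. A f + 2 * loss f x) ` G) \<partial>M)"
  proof -
    have "A f + 2 * expectation (loss f) \<le> (\<integral>x. Max ((\<lambda>f. A f + 2 * loss f x) ` G) \<partial>M)" if f: "f \<in> G" for f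
    proof -
      have "A f + 2 * expectation (loss f) = (\<integral>x. A f + 2 * loss f x \<partial>M)"
        using int_loss[OF f] by (simp add: prob_space)
      also have "\<dots> \<le> (\<integral>x. Max ((\<lambda>f. A f + 2 * loss f x) ` G) \<partial>M)"
        using int_loss[OF f] f G by (intro integral_mono i2) (auto intro!: Max_ge)
      finally show ?thesis .
    qed
    then show ?thesis unfolding J_def using G by simp
  qed
  have split: "Max ((\<lambda>f. A f + (expectation (loss f) - loss f x)) ` G) \<le> (J + Max ((\<lambda>f. A f - 2 * loss f x) ` G)) / 2" for x
  proof -
    have "A f + (expectation (loss f) - loss f x) \<le> (J + Max ((\<lambda>f. A f - 2 * loss f x) ` G)) / 2" if f: "f \<in> G" for f
    proof -
      have "A f + 2 * expectation (loss f) \<le> J" "A f - 2 * loss f x \<le> Max ((\<lambda>f. A f - 2 * loss f x) ` G)"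
        unfolding J_def using f G by (auto intro!: Max_ge)
      then show ?thesis by simp
    qed
    then show ?thesis using G by (intro Max.boundedI) auto
  qed
  have "(\<integral>x. Max ((\<lambda>f. A f + (expectation (loss f) - loss f x)) ` G) \<partial>M)
      \<le> (\<integral>x. (J + Max ((\<lambda>f. A f - 2 * loss f x) ` G)) / 2 \<partial>M)"
    by (intro integral_mono split i1 integrable_divide Bochner_Integration.integrable_add i3) auto
  also have "\<dots> = (J + (\<integral>x. Max ((\<lambda>f. A f - 2 * loss f x) ` G) \<partial>M)) / 2"
    using i3 by (simp add: prob_space)
  also have "\<dots> \<le> ((\<integral>x. Max ((\<lambda>f. A f + 2 * loss f x) ` G) \<partial>M) + (\<integral>x. Max ((\<lambda>f. A f - 2 * loss f x) ` G) \<partial>M)) / 2"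
    using jensen by simp
  also have "\<dots> = (\<integral>x. (Max ((\<lambda>f. A f + 2 * loss f x) ` G) + Max ((\<lambda>f. A f - 2 * loss f x) ` G)) / 2 \<partial>M)"
    using i2 i3 by simp
  \<comment> \<open>Contraction acts here pointwise in \<open>x\<close>, on the two opposite signs
    of the same summand. The 2 in \<open>2 * L\<close> comes from halving \<open>A\<close>, which
    doubles the loss.\<close>
  also have "\<dots> \<le> (\<integral>x. (Max ((\<lambda>f. A f + 2 * L * a f x) ` G) + Max ((\<lambda>f. A f - 2 * L * a f x) ` G)) / 2 \<partial>M)"
  proof (intro integral_mono divide_right_mono Max_add_contraction G)
    show "\<bar>2 * loss f x - 2 * loss g x\<bar> \<le> \<bar>2 * L * a f x - 2 * L * a g x\<bar>"
      if "x \<in> space M" "f \<in> G" "g \<in> G" for x f g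
    proof -
      have "\<bar>2 * L * a f x - 2 * L * a g x\<bar> = 2 * (L * \<bar>a f x - a g x\<bar>)"
        using L by (simp add: abs_mult flip: right_diff_distrib mult.assoc)
      then show ?thesis using contr[OF that(2,3,1)] by linarith
    qed
  qed (use i2 i3 i4 i5 in auto)
  finally show ?thesis .
qed

text \<open>A hybrid argument that exchanges \<open>p\<close> for \<open>q\<close> one coordinate at
  a time. While one coordinate is treated, the contributions of all others are frozen into the
  offset \<open>A\<close>; this is why \<open>step\<close> is required for every nonnegative offset
  and why \<open>A\<close> is generalized in the induction.\<close>

lemma (in product_prob_space) Max_sum_replace:
  fixes p q :: "'f \<Rightarrow> 'a \<Rightarrow> real"
  assumes "finite J" and G: "finite G" "G \<noteq> {}"
    and meas[measurable]: "\<And>f i. f \<in> G \<Longrightarrow> p f \<in> borel_measurable (M i)" "\<And>f i. f \<in> G \<Longrightarrow> q f \<in> borel_measurable (M i)"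
    and p_nonneg: "\<And>f x. f \<in> G \<Longrightarrow> 0 \<le> p f x" and q_nonneg: "\<And>f x. f \<in> G \<Longrightarrow> 0 \<le> q f x"
    and step: "\<And>i A. (\<And>f. f \<in> G \<Longrightarrow> 0 \<le> A f) \<Longrightarrow>
         (\<integral>\<^sup>+u. ennreal (Max ((\<lambda>f. A f + p f u) ` G)) \<partial>M i) \<le> (\<integral>\<^sup>+u. ennreal (Max ((\<lambda>f. A f + q f u) ` G)) \<partial>M i)"
    and "\<And>f. f \<in> G \<Longrightarrow> 0 \<le> A f"
  shows "(\<integral>\<^sup>+x. ennreal (Max ((\<lambda>f. A f + (\<Sum>i\<in>J. p f (x i))) ` G)) \<partial>PiM J M)
       \<le> (\<integral>\<^sup>+x. ennreal (Max ((\<lambda>f. A f + (\<Sum>i\<in>J. q f (x i))) ` G)) \<partial>PiM J M)"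
  using assms(1) assms(9)
proof (induction J arbitrary: A rule: finite_induct)
  case (insert i J)
  have [measurable]: "(\<lambda>x. \<Sum>j\<in>J. r f (x j)) \<in> borel_measurable (PiM J' M)"
    if "f \<in> G" "J \<subseteq> J'" "r = p \<or> r = q" for f r J J'
  proof (intro borel_measurable_sum)
    fix j assume "j \<in> J"
    with that have "j \<in> J'" "r f \<in> borel_measurable (M j)" by auto
    then show "(\<lambda>x. r f (x j)) \<in> borel_measurable (PiM J' M)" by measurable
  qed
  have upd: "(\<Sum>j\<in>J. r f ((x(i := y)) j)) = (\<Sum>j\<in>J. r f (x j))" for r :: "'f \<Rightarrow> 'a \<Rightarrow> real" and f x y
    using insert.hyps by (intro sum.cong) auto
  have "(\<integral>\<^sup>+x. ennreal (Max ((\<lambda>f. A f + (\<Sum>j\<in>insert i J. p f (x j))) ` G)) \<partial>PiM (insert i J) M)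
      = (\<integral>\<^sup>+x. (\<integral>\<^sup>+y. ennreal (Max ((\<lambda>f. (A f + (\<Sum>j\<in>J. p f (x j))) + p f y) ` G)) \<partial>M i) \<partial>PiM J M)"
    using insert.hyps G
    by (subst product_nn_integral_insert) (auto simp: upd fun_upd_same ac_simps simp del: fun_upd_apply)
  also have "\<dots> \<le> (\<integral>\<^sup>+x. (\<integral>\<^sup>+y. ennreal (Max ((\<lambda>f. (A f + (\<Sum>j\<in>J. p f (x j))) + q f y) ` G)) \<partial>M i) \<partial>PiM J M)"
    by (intro nn_integral_mono step add_nonneg_nonneg sum_nonneg p_nonneg insert.prems)
  \<comment> \<open>After the exchange of integrals the coordinate already replaced becomes part of
    the offset for the induction hypothesis.\<close>
  also have "\<dots> = (\<integral>\<^sup>+y. (\<integral>\<^sup>+x. ennreal (Max ((\<lambda>f. (A f + q f y) + (\<Sum>j\<in>J. p f (x j))) ` G)) \<partial>PiM J M) \<partial>M i)"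
    using G by (subst pair_sigma_finite.Fubini')
      (auto intro!: pair_sigma_finite.intro prob_space_imp_sigma_finite prob_space_PiM prob_space simp: ac_simps)
  also have "\<dots> \<le> (\<integral>\<^sup>+y. (\<integral>\<^sup>+x. ennreal (Max ((\<lambda>f. (A f + q f y) + (\<Sum>j\<in>J. q f (x j))) ` G)) \<partial>PiM J M) \<partial>M i)"
    by (intro nn_integral_mono insert.IH add_nonneg_nonneg q_nonneg insert.prems)
  also have "\<dots> = (\<integral>\<^sup>+x. ennreal (Max ((\<lambda>f. A f + (\<Sum>j\<in>insert i J. q f (x j))) ` G)) \<partial>PiM (insert i J) M)"
    using insert.hyps G
    by (subst product_nn_integral_insert_rev) (auto simp: upd fun_upd_same ac_simps simp del: fun_upd_apply)
  finally show ?case .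
qed simp

text \<open>The coordinatewise argument runs over independent pairs (point, sign), whereas the
  Rademacher complexity integrates over all points and all signs as two separate families. Both laws
  agree on rectangles, where the indicator is a product over the coordinates.\<close>

lemma distr_PiM_pair:
  assumes I: "finite I" and M: "\<And>i. prob_space (M i)" and N: "\<And>i. prob_space (N i)"
  shows "distr (PiM I M \<Otimes>\<^sub>M PiM I N) (PiM I (\<lambda>i. M i \<Otimes>\<^sub>M N i)) (\<lambda>u. \<lambda>i\<in>I. (fst u i, snd u i))
           = PiM I (\<lambda>i. M i \<Otimes>\<^sub>M N i)"
proof -
  interpret M: product_prob_space M I by (rule product_prob_spaceI[OF M])
  interpret N: product_prob_space N I by (rule product_prob_spaceI[OF N])
  interpret MN: product_sigma_finite "\<lambda>i. M i \<Otimes>\<^sub>M N i"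
    by (intro product_sigma_finite.intro prob_space_imp_sigma_finite prob_space_pair M N)
  show ?thesis
  proof (rule MN.PiM_eqI[OF I])
    fix A assume A[measurable]: "\<And>i. i \<in> I \<Longrightarrow> A i \<in> sets (M i \<Otimes>\<^sub>M N i)"
    have meas[measurable]: "(\<lambda>u. \<lambda>i\<in>I. (fst u i, snd u i)) \<in> PiM I M \<Otimes>\<^sub>M PiM I N \<rightarrow>\<^sub>M PiM I (\<lambda>i. M i \<Otimes>\<^sub>M N i)"
      by (intro measurable_restrict) measurable
    have ind: "indicator (Pi\<^sub>E I A) (\<lambda>i\<in>I. (fst u i, snd u i)) = (\<Prod>i\<in>I. indicator (A i) (fst u i, snd u i) :: ennreal)" for u
      using I by (auto simp: indicator_def PiE_iff prod_zero_iff intro!: prod.neutral)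
    have [measurable]: "Pi\<^sub>E I A \<in> sets (PiM I (\<lambda>i. M i \<Otimes>\<^sub>M N i))"
      using I by (intro sets_PiM_I_finite) auto
    have [measurable]: "(\<lambda>x. indicator (A i) (fst x i, snd x i) :: ennreal) \<in> borel_measurable (PiM I M \<Otimes>\<^sub>M PiM I N)" if "i \<in> I" for i
      using that by measurable
    have "emeasure (distr (PiM I M \<Otimes>\<^sub>M PiM I N) (PiM I (\<lambda>i. M i \<Otimes>\<^sub>M N i)) (\<lambda>u. \<lambda>i\<in>I. (fst u i, snd u i))) (Pi\<^sub>E I A)
        = (\<integral>\<^sup>+v. indicator (Pi\<^sub>E I A) v \<partial>distr (PiM I M \<Otimes>\<^sub>M PiM I N) (PiM I (\<lambda>i. M i \<Otimes>\<^sub>M N i)) (\<lambda>u. \<lambda>i\<in>I. (fst u i, snd u i)))"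
      by simp
    also have "\<dots> = (\<integral>\<^sup>+u. (\<Prod>i\<in>I. indicator (A i) (fst u i, snd u i)) \<partial>(PiM I M \<Otimes>\<^sub>M PiM I N))"
      by (subst nn_integral_distr) (simp_all only: ind, measurable)
    also have "\<dots> = (\<integral>\<^sup>+x. (\<integral>\<^sup>+y. (\<Prod>i\<in>I. indicator (A i) (x i, y i)) \<partial>PiM I N) \<partial>PiM I M)"
      by (subst N.P.nn_integral_fst[symmetric]) simp_all
    also have "\<dots> = (\<integral>\<^sup>+x. (\<Prod>i\<in>I. \<integral>\<^sup>+t. indicator (A i) (x i, t) \<partial>N i) \<partial>PiM I M)"
    proof (intro nn_integral_cong N.product_nn_integral_prod I)
      fix x i assume "x \<in> space (PiM I M)" and i[measurable]: "i \<in> I"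
      then have [measurable]: "x i \<in> space (M i)" by (auto simp: space_PiM)
      show "(\<lambda>t. indicator (A i) (x i, t)) \<in> borel_measurable (N i)"
        by measurable
    qed
    also have "\<dots> = (\<Prod>i\<in>I. \<integral>\<^sup>+s. \<integral>\<^sup>+t. indicator (A i) (s, t) \<partial>N i \<partial>M i)"
      by (intro M.product_nn_integral_prod I) measurable
    also have "\<dots> = (\<Prod>i\<in>I. emeasure (M i \<Otimes>\<^sub>M N i) (A i))"
      by (intro prod.cong refl) (simp add: N.M.emeasure_pair_measure)
    finally show "emeasure (distr (PiM I M \<Otimes>\<^sub>M PiM I N) (PiM I (\<lambda>i. M i \<Otimes>\<^sub>M N i)) (\<lambda>u. \<lambda>i\<in>I. (fst u i, snd u i))) (Pi\<^sub>E I A)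
        = (\<Prod>i\<in>I. emeasure (M i \<Otimes>\<^sub>M N i) (A i))" .
  qed simp
qed

text \<open>Iterates the one-coordinate symmetrization with \<open>Max_sum_replace\<close>. The
  argument itself yields a maximum of signed sums; the absolute values are inserted at the end to
  match the definition of the complexity. The bound \<open>C\<close> secures integrability and does
  not enter the estimate.\<close>

lemma (in prob_space) expected_sup_deviation_le:
  fixes loss a :: "'f \<Rightarrow> 'a \<Rightarrow> real" and I :: "'i set"
  defines "S \<equiv> measure_pmf (pmf_of_set {-1, 1::real})"
  assumes I: "finite I" and G: "finite G" "G \<noteq> {}" and L: "L \<ge> 0"
    and meas: "\<And>f. f \<in> G \<Longrightarrow> loss f \<in> borel_measurable M" "\<And>f. f \<in> G \<Longrightarrow> a f \<in> borel_measurable M"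
    and loss_bdd: "\<And>f x. f \<in> G \<Longrightarrow> x \<in> space M \<Longrightarrow> \<bar>loss f x\<bar> \<le> C"
    and a_bdd: "\<And>f x. f \<in> G \<Longrightarrow> x \<in> space M \<Longrightarrow> \<bar>a f x\<bar> \<le> C"
    and contr: "\<And>f g x. f \<in> G \<Longrightarrow> g \<in> G \<Longrightarrow> x \<in> space M \<Longrightarrow> \<bar>loss f x - loss g x\<bar> \<le> L * \<bar>a f x - a g x\<bar>"
  shows "ennreal (\<integral>x. Max ((\<lambda>f. \<Sum>i\<in>I. expectation (loss f) - loss f (x i)) ` G) \<partial>PiM I (\<lambda>_. M))
       \<le> (\<integral>\<^sup>+u. ennreal (2 * L * Max ((\<lambda>f. \<bar>\<Sum>i\<in>I. snd u i * a f (fst u i)\<bar>) ` G))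
            \<partial>(PiM I (\<lambda>_. M) \<Otimes>\<^sub>M PiM I (\<lambda>_. S)))"
proof -
  have S: "prob_space S" unfolding S_def by (rule prob_space_measure_pmf)
  interpret S: prob_space S by (rule S)
  have sets_S[measurable_cong]: "sets S = UNIV" by (simp add: S_def)
  interpret MI: prob_space "PiM I (\<lambda>_. M)" by (intro prob_space_PiM prob_space_axioms)
  interpret SI: prob_space "PiM I (\<lambda>_. S)" by (intro prob_space_PiM S)
  interpret MS: product_prob_space "\<lambda>_. M \<Otimes>\<^sub>M S" I
    by (intro product_prob_spaceI prob_space_pair prob_space_axioms S)
  obtain f0 where f0: "f0 \<in> G" using G by auto
  obtain x0 where x0: "x0 \<in> space M" using not_empty by auto
  have C: "C \<ge> 0" using loss_bdd[OF f0 x0] by linarith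
  have int_loss: "integrable M (loss f)" if "f \<in> G" for f
    using that by (intro integrable_const_bound[where B=C] AE_I2) (auto intro: loss_bdd meas)
  have E_bdd: "\<bar>expectation (loss f)\<bar> \<le> C" if f: "f \<in> G" for f
  proof -
    have "\<bar>expectation (loss f)\<bar> \<le> (\<integral>x. \<bar>loss f x\<bar> \<partial>M)" by (rule integral_abs_bound)
    also have "\<dots> \<le> (\<integral>x. C \<partial>M)" using f by (intro integral_mono integrable_abs int_loss loss_bdd) auto
    finally show ?thesis by (simp add: prob_space)
  qed
  \<comment> \<open>Shifting by \<open>K\<close>, and replacing signs and functions by everywhere bounded versions, makes all summands
    nonnegative, so that \<open>Max_sum_replace\<close> applies and needs no integrability.\<close>
  define K where "K = 2 * C + 2 * L * C"
  have K: "K \<ge> 0" using C L by (simp add: K_def)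
  define sg where "sg s = (if s = 1 then 1 else - 1 :: real)" for s :: real
  define loss' where "loss' f x = (if x \<in> space M then loss f x else 0)" for f x
  define a' where "a' f x = (if x \<in> space M then a f x else 0)" for f x
  have [measurable]: "loss' f \<in> borel_measurable M" "a' f \<in> borel_measurable M" if "f \<in> G" for f
    using meas[OF that] by (auto simp: loss'_def a'_def cong: measurable_cong)
  have [measurable]: "sg \<in> borel_measurable S" by (simp add: S_def)
  have E': "expectation (loss' f) = expectation (loss f)" for f
    by (intro Bochner_Integration.integral_cong) (auto simp: loss'_def)
  have loss'_bdd: "\<bar>loss' f x\<bar> \<le> C" and a'_bdd: "\<bar>a' f x\<bar> \<le> C" if "f \<in> G" for f x
    using that C loss_bdd a_bdd by (auto simp: loss'_def a'_def)
  have La: "\<bar>2 * L * a' f x\<bar> \<le> 2 * L * C" if "f \<in> G" for f x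
    using a'_bdd[OF that, of x] L by (simp add: abs_mult mult_left_mono)
  have contr': "\<bar>loss' f x - loss' g x\<bar> \<le> L * \<bar>a' f x - a' g x\<bar>" if "f \<in> G" "g \<in> G" for f g x
    using contr[OF that, of x] L by (simp add: loss'_def a'_def)
  define p where "p f u = (expectation (loss f) - loss' f (fst u)) + K" for f and u :: "'a \<times> real"
  define q where "q f u = 2 * L * (sg (snd u) * a' f (fst u)) + K" for f and u :: "'a \<times> real"
  \<comment> \<open>Of the two terms of \<open>K\<close>, \<open>2 * C\<close> compensates the
    deviation of the loss in \<open>p\<close>, and \<open>2 * L * C\<close> compensates the signed
    term in \<open>q\<close>.\<close>
  have p_nonneg: "0 \<le> p f u" if "f \<in> G" for f u
  proof -
    have "0 \<le> 2 * L * C" using L C by simp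
    then show ?thesis
      using E_bdd[OF that] loss'_bdd[OF that, of "fst u"] unfolding p_def K_def by linarith
  qed
  have q_nonneg: "0 \<le> q f u" if "f \<in> G" for f u
  proof -
    have "\<bar>2 * L * (sg (snd u) * a' f (fst u))\<bar> = \<bar>2 * L * a' f (fst u)\<bar>"
      by (simp add: sg_def abs_mult)
    then show ?thesis using La[OF that, of "fst u"] C unfolding q_def K_def by linarith
  qed
  have [measurable]: "p f \<in> borel_measurable (M \<Otimes>\<^sub>M S)" "q f \<in> borel_measurable (M \<Otimes>\<^sub>M S)" if "f \<in> G" for f
    using that unfolding p_def q_def by measurable
  have step: "(\<integral>\<^sup>+u. ennreal (Max ((\<lambda>f. A f + p f u) ` G)) \<partial>(M \<Otimes>\<^sub>M S))
      \<le> (\<integral>\<^sup>+u. ennreal (Max ((\<lambda>f. A f + q f u) ` G)) \<partial>(M \<Otimes>\<^sub>M S))" if A: "\<And>f. f \<in> G \<Longrightarrow> 0 \<le> A f" for A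
  proof -
    define AK where "AK = Max ((\<lambda>f. \<bar>A f\<bar>) ` G)"
    have AK: "\<bar>A f\<bar> \<le> AK" if "f \<in> G" for f
      unfolding AK_def using G that by (intro Max_ge) auto
    have nonneg: "0 \<le> Max (h ` G)" if "\<And>f. f \<in> G \<Longrightarrow> 0 \<le> h f" for h :: "'f \<Rightarrow> real"
      using that[OF f0] f0 G by (intro order_trans[OF that[OF f0] Max_ge]) auto
    have int_Max: "integrable M (\<lambda>x. Max ((\<lambda>f. h f x) ` G))"
      if [measurable]: "\<And>f. f \<in> G \<Longrightarrow> h f \<in> borel_measurable M"
        and "\<And>f x. f \<in> G \<Longrightarrow> \<bar>h f x\<bar> \<le> D" for h :: "'f \<Rightarrow> 'a \<Rightarrow> real" and D
    proof (rule integrable_const_bound[where B=D])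
      show "AE x in M. norm (Max ((\<lambda>f. h f x) ` G)) \<le> D"
        using that G by (intro AE_I2) (auto intro!: abs_Max_image_le)
    qed (use G in measurable)
    have b1: "\<bar>(A f + K) + (expectation (loss f) - loss' f x)\<bar> \<le> AK + K + 2 * C" if f: "f \<in> G" for f x
      using AK[OF f] E_bdd[OF f] loss'_bdd[OF f, of x] K by linarith
    have b2: "\<bar>(A f + K) + 2 * L * a' f x\<bar> \<le> AK + K + 2 * L * C"
      and b3: "\<bar>(A f + K) - 2 * L * a' f x\<bar> \<le> AK + K + 2 * L * C" if f: "f \<in> G" for f x
      using AK[OF f] La[OF f, of x] K by linarith+
    have i1: "integrable M (\<lambda>x. Max ((\<lambda>f. (A f + K) + (expectation (loss f) - loss' f x)) ` G))"
      by (rule int_Max[of _ "AK + K + 2 * C"]) (measurable, rule b1)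
    have i2: "integrable M (\<lambda>x. Max ((\<lambda>f. (A f + K) + 2 * L * a' f x) ` G))"
      by (rule int_Max[of _ "AK + K + 2 * L * C"]) (measurable, rule b2)
    have i3: "integrable M (\<lambda>x. Max ((\<lambda>f. (A f + K) - 2 * L * a' f x) ` G))"
      by (rule int_Max[of _ "AK + K + 2 * L * C"]) (measurable, rule b3)
    have n1: "0 \<le> Max ((\<lambda>f. (A f + K) + (expectation (loss f) - loss' f x)) ` G)" for x
      using add_nonneg_nonneg[OF A p_nonneg[of _ "(x, 0)"]] by (intro nonneg) (simp add: p_def ac_simps)
    have n2: "0 \<le> Max ((\<lambda>f. (A f + K) + 2 * L * a' f x) ` G)" for x
      using add_nonneg_nonneg[OF A q_nonneg[of _ "(x, 1)"]] by (intro nonneg) (simp add: q_def sg_def algebra_simps)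
    \<comment> \<open>\<open>sg\<close> sends every number other than 1 to -1, so the second
      component 0 stands for the negative sign.\<close>
    have n3: "0 \<le> Max ((\<lambda>f. (A f + K) - 2 * L * a' f x) ` G)" for x
      using add_nonneg_nonneg[OF A q_nonneg[of _ "(x, 0)"]] by (intro nonneg) (simp add: q_def sg_def algebra_simps)
    have "(\<integral>\<^sup>+u. ennreal (Max ((\<lambda>f. A f + p f u) ` G)) \<partial>(M \<Otimes>\<^sub>M S))
        = (\<integral>\<^sup>+x. (\<integral>\<^sup>+s. ennreal (Max ((\<lambda>f. A f + p f (x, s)) ` G)) \<partial>S) \<partial>M)"
      using G by (subst S.nn_integral_fst[symmetric]) auto
    also have "\<dots> = (\<integral>\<^sup>+x. ennreal (Max ((\<lambda>f. (A f + K) + (expectation (loss f) - loss' f x)) ` G)) \<partial>M)"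
      by (simp add: p_def S.emeasure_space_1 ac_simps)
    also have "\<dots> = ennreal (\<integral>x. Max ((\<lambda>f. (A f + K) + (expectation (loss f) - loss' f x)) ` G) \<partial>M)"
      by (intro nn_integral_eq_integral i1 AE_I2 n1)
    also have "\<dots> \<le> ennreal (\<integral>x. (Max ((\<lambda>f. (A f + K) + 2 * L * a' f x) ` G) + Max ((\<lambda>f. (A f + K) - 2 * L * a' f x) ` G)) / 2 \<partial>M)"
      unfolding E'[symmetric]
      by (intro ennreal_leI symmetrization_contraction[where C=C] G L loss'_bdd a'_bdd contr'; measurable)
    also have "\<dots> = (\<integral>\<^sup>+x. ennreal ((Max ((\<lambda>f. (A f + K) + 2 * L * a' f x) ` G) + Max ((\<lambda>f. (A f + K) - 2 * L * a' f x) ` G)) / 2) \<partial>M)"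
      using n2 n3 by (intro nn_integral_eq_integral[symmetric] integrable_divide Bochner_Integration.integrable_add i2 i3 AE_I2) simp
    also have "\<dots> = (\<integral>\<^sup>+x. (\<integral>\<^sup>+s. ennreal (Max ((\<lambda>f. A f + q f (x, s)) ` G)) \<partial>S) \<partial>M)"
    proof (intro nn_integral_cong)
      fix x
      have "(\<integral>\<^sup>+s. ennreal (Max ((\<lambda>f. A f + q f (x, s)) ` G)) \<partial>S)
          = (ennreal (Max ((\<lambda>f. A f + q f (x, - 1)) ` G)) + ennreal (Max ((\<lambda>f. A f + q f (x, 1)) ` G))) / 2"
        unfolding S_def by (subst nn_integral_pmf_of_set) auto
      also have "(\<lambda>f. A f + q f (x, - 1)) = (\<lambda>f. (A f + K) - 2 * L * a' f x)"
        by (auto simp: q_def sg_def)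
      also have "(\<lambda>f. A f + q f (x, 1)) = (\<lambda>f. (A f + K) + 2 * L * a' f x)"
        by (auto simp: q_def sg_def)
      finally show "ennreal ((Max ((\<lambda>f. (A f + K) + 2 * L * a' f x) ` G) + Max ((\<lambda>f. (A f + K) - 2 * L * a' f x) ` G)) / 2)
          = (\<integral>\<^sup>+s. ennreal (Max ((\<lambda>f. A f + q f (x, s)) ` G)) \<partial>S)"
        using n2[of x] n3[of x] by (simp add: divide_ennreal[symmetric] add.commute flip: ennreal_plus)
    qed
    also have "\<dots> = (\<integral>\<^sup>+u. ennreal (Max ((\<lambda>f. A f + q f u) ` G)) \<partial>(M \<Otimes>\<^sub>M S))"
      using G by (subst S.nn_integral_fst[symmetric]) auto
    finally show ?thesis .
  qed

  \<comment> \<open>Transfer from pairs to separate families of points and signs\<close>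
  define P where "P = PiM I (\<lambda>_. M) \<Otimes>\<^sub>M PiM I (\<lambda>_. S)"
  define T where "T u = (\<lambda>i\<in>I. (fst u i, snd u i))" for u :: "('i \<Rightarrow> 'a) \<times> ('i \<Rightarrow> real)"
  have [measurable]: "T \<in> P \<rightarrow>\<^sub>M PiM I (\<lambda>_. M \<Otimes>\<^sub>M S)"
    unfolding T_def P_def by (intro measurable_restrict) measurable
  have distr_T: "PiM I (\<lambda>_. M \<Otimes>\<^sub>M S) = distr P (PiM I (\<lambda>_. M \<Otimes>\<^sub>M S)) T"
    unfolding P_def T_def by (rule distr_PiM_pair[symmetric]) (auto intro: I prob_space_axioms S)
  have msum[measurable]: "(\<lambda>v. \<Sum>i\<in>I. r f (v i)) \<in> borel_measurable (PiM I (\<lambda>_. M \<Otimes>\<^sub>M S))"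
    if "f \<in> G" "r = p \<or> r = q" for r f
  proof (intro borel_measurable_sum)
    fix i assume "i \<in> I"
    moreover have "r f \<in> borel_measurable (M \<Otimes>\<^sub>M S)" using that by auto
    ultimately show "(\<lambda>v. r f (v i)) \<in> borel_measurable (PiM I (\<lambda>_. M \<Otimes>\<^sub>M S))" by measurable
  qed
  have pull: "(\<integral>\<^sup>+v. ennreal (Max ((\<lambda>f. \<Sum>i\<in>I. r f (v i)) ` G)) \<partial>PiM I (\<lambda>_. M \<Otimes>\<^sub>M S))
      = (\<integral>\<^sup>+u. ennreal (Max ((\<lambda>f. \<Sum>i\<in>I. r f (fst u i, snd u i)) ` G)) \<partial>P)" if r: "r = p \<or> r = q" for r
  proof -
    have [measurable]: "(\<lambda>v. ennreal (Max ((\<lambda>f. \<Sum>i\<in>I. r f (v i)) ` G))) \<in> borel_measurable (PiM I (\<lambda>_. M \<Otimes>\<^sub>M S))"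
      using G r by (intro measurable_compose[OF _ measurable_ennreal] borel_measurable_Max msum) auto
    show ?thesis
      by (subst distr_T, subst nn_integral_distr) (auto simp: T_def cong: sum.cong)
  qed
  define m where "m = real (card I)"
  define D where "D = (\<integral>x. Max ((\<lambda>f. \<Sum>i\<in>I. expectation (loss f) - loss f (x i)) ` G) \<partial>PiM I (\<lambda>_. M))"
  define X where "X u = Max ((\<lambda>f. \<bar>\<Sum>i\<in>I. snd u i * a f (fst u i)\<bar>) ` G)" for u :: "('i \<Rightarrow> 'a) \<times> ('i \<Rightarrow> real)"
  have in_space: "x i \<in> space M" if "x \<in> space (PiM I (\<lambda>_. M))" "i \<in> I" for x i
    using that by (auto simp: space_PiM)
  have msum1: "(\<lambda>x. \<Sum>i\<in>I. expectation (loss f) - loss f (x i)) \<in> borel_measurable (PiM I (\<lambda>_. M))" if "f \<in> G" for f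
  proof (intro borel_measurable_sum)
    fix i assume "i \<in> I"
    moreover note meas(1)[OF that, measurable]
    ultimately show "(\<lambda>x. expectation (loss f) - loss f (x i)) \<in> borel_measurable (PiM I (\<lambda>_. M))" by measurable
  qed
  have sum_bdd: "\<bar>\<Sum>i\<in>I. expectation (loss f) - loss f (x i)\<bar> \<le> m * (2 * C)"
    if f: "f \<in> G" and x: "x \<in> space (PiM I (\<lambda>_. M))" for f x
  proof -
    have "\<bar>\<Sum>i\<in>I. expectation (loss f) - loss f (x i)\<bar> \<le> (\<Sum>i\<in>I. \<bar>expectation (loss f) - loss f (x i)\<bar>)" by (rule sum_abs)
    also have "\<dots> \<le> (\<Sum>i\<in>I. 2 * C)"
      using E_bdd[OF f] loss_bdd[OF f in_space[OF x]] by (intro sum_mono) (smt (verit))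
    finally show ?thesis by (simp add: m_def)
  qed
  have intD: "integrable (PiM I (\<lambda>_. M)) (\<lambda>x. Max ((\<lambda>f. \<Sum>i\<in>I. expectation (loss f) - loss f (x i)) ` G))"
    using G sum_bdd msum1
    by (intro MI.integrable_const_bound[where B="m * (2 * C)"] AE_I2 borel_measurable_Max)
       (auto intro!: abs_Max_image_le)
  have sum_p: "Max ((\<lambda>f. \<Sum>i\<in>I. p f (x i, s i)) ` G) = Max ((\<lambda>f. \<Sum>i\<in>I. expectation (loss f) - loss f (x i)) ` G) + m * K"
    if "x \<in> space (PiM I (\<lambda>_. M))" for x s
    using in_space[OF that] G
    by (simp add: p_def loss'_def sum.distrib m_def Max_add_commute del: Max_less_iff cong: sum.cong)
  have "ennreal (D + m * K) = ennreal (\<integral>x. Max ((\<lambda>f. \<Sum>i\<in>I. expectation (loss f) - loss f (x i)) ` G) + m * K \<partial>PiM I (\<lambda>_. M))"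
    unfolding D_def using intD by (simp add: MI.prob_space)
  also have "\<dots> = (\<integral>\<^sup>+x. ennreal (Max ((\<lambda>f. \<Sum>i\<in>I. expectation (loss f) - loss f (x i)) ` G) + m * K) \<partial>PiM I (\<lambda>_. M))"
  proof (intro nn_integral_eq_integral[symmetric] AE_I2)
    fix x assume x: "x \<in> space (PiM I (\<lambda>_. M))"
    have "0 \<le> (\<Sum>i\<in>I. p f0 (x i, 0))" by (intro sum_nonneg p_nonneg f0)
    also have "\<dots> \<le> Max ((\<lambda>f. \<Sum>i\<in>I. p f (x i, 0)) ` G)" using G f0 by (intro Max_ge) auto
    finally show "0 \<le> Max ((\<lambda>f. \<Sum>i\<in>I. expectation (loss f) - loss f (x i)) ` G) + m * K"
      using sum_p[OF x, of "\<lambda>_. 0"] by simp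
  qed (use intD in auto)
  also have "\<dots> = (\<integral>\<^sup>+x. (\<integral>\<^sup>+s. ennreal (Max ((\<lambda>f. \<Sum>i\<in>I. p f (x i, s i)) ` G)) \<partial>PiM I (\<lambda>_. S)) \<partial>PiM I (\<lambda>_. M))"
    by (intro nn_integral_cong) (simp add: sum_p SI.emeasure_space_1)
  also have "\<dots> = (\<integral>\<^sup>+u. ennreal (Max ((\<lambda>f. \<Sum>i\<in>I. p f (fst u i, snd u i)) ` G)) \<partial>P)"
  proof -
    have "(\<lambda>u. ennreal (Max ((\<lambda>f. \<Sum>i\<in>I. p f (T u i)) ` G))) \<in> borel_measurable P"
      using G by (intro measurable_compose[OF _ measurable_ennreal] borel_measurable_Max measurable_compose[OF _ msum, of T]) auto
    then have "(\<lambda>u. ennreal (Max ((\<lambda>f. \<Sum>i\<in>I. p f (fst u i, snd u i)) ` G))) \<in> borel_measurable P"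
      by (simp add: T_def cong: sum.cong)
    then show ?thesis unfolding P_def by (subst SI.nn_integral_fst[symmetric]) auto
  qed
  also have "\<dots> = (\<integral>\<^sup>+v. ennreal (Max ((\<lambda>f. \<Sum>i\<in>I. p f (v i)) ` G)) \<partial>PiM I (\<lambda>_. M \<Otimes>\<^sub>M S))"
    by (rule pull[symmetric]) simp
  also have "\<dots> \<le> (\<integral>\<^sup>+v. ennreal (Max ((\<lambda>f. \<Sum>i\<in>I. q f (v i)) ` G)) \<partial>PiM I (\<lambda>_. M \<Otimes>\<^sub>M S))"
    using MS.Max_sum_replace[OF I G, of p q "\<lambda>_. 0"] step p_nonneg q_nonneg by simp
  also have "\<dots> = (\<integral>\<^sup>+u. ennreal (Max ((\<lambda>f. \<Sum>i\<in>I. q f (fst u i, snd u i)) ` G)) \<partial>P)"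
    by (rule pull) simp
  also have "\<dots> \<le> (\<integral>\<^sup>+u. ennreal (2 * L * X u) + ennreal (m * K) \<partial>P)"
  proof (rule nn_integral_mono_AE)
    \<comment> \<open>The space of \<open>S\<close> is the whole real line, so \<open>sg\<close> can
      be replaced by the sign itself only almost surely.\<close>
    have "AE s in PiM I (\<lambda>_. S). \<forall>i\<in>I. s i \<in> {-1, 1}"
    proof (intro AE_finite_allI I AE_PiM_component S)
      show "AE s in S. s \<in> {-1, 1}" unfolding S_def by (simp add: AE_measure_pmf_iff)
    qed
    then have "AE x in PiM I (\<lambda>_. M). AE s in PiM I (\<lambda>_. S). \<forall>i\<in>I. snd (x, s) i \<in> {-1, 1}" by simp
    then have "AE u in P. \<forall>i\<in>I. snd u i \<in> {-1, 1}"
      unfolding P_def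
    proof (rule pair_sigma_finite.AE_pair_measure[rotated 2])
      have [measurable]: "{-1, 1} \<in> sets S" by (simp add: S_def)
      show "{u \<in> space (PiM I (\<lambda>_. M) \<Otimes>\<^sub>M PiM I (\<lambda>_. S)). \<forall>i\<in>I. snd u i \<in> {-1, 1}}
          \<in> sets (PiM I (\<lambda>_. M) \<Otimes>\<^sub>M PiM I (\<lambda>_. S))"
        using I by measurable
    qed (intro pair_sigma_finite.intro MI.sigma_finite_measure_axioms SI.sigma_finite_measure_axioms)
    then show "AE u in P. ennreal (Max ((\<lambda>f. \<Sum>i\<in>I. q f (fst u i, snd u i)) ` G)) \<le> ennreal (2 * L * X u) + ennreal (m * K)"
    proof (rule AE_mp, intro AE_I2 impI)
      fix u assume u: "u \<in> space P" and sgn: "\<forall>i\<in>I. snd u i \<in> {-1, 1}"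
      have X0: "0 \<le> X u" unfolding X_def using G f0 by (intro order_trans[OF abs_ge_zero Max_ge]) auto
      have "(\<Sum>i\<in>I. q f (fst u i, snd u i)) \<le> 2 * L * X u + m * K" if f: "f \<in> G" for f
      proof -
        have "(\<Sum>i\<in>I. q f (fst u i, snd u i)) = (\<Sum>i\<in>I. 2 * L * (snd u i * a f (fst u i)) + K)"
          using sgn in_space[of "fst u"] u
          by (intro sum.cong) (auto simp: q_def sg_def a'_def P_def space_pair_measure)
        also have "\<dots> = 2 * L * (\<Sum>i\<in>I. snd u i * a f (fst u i)) + m * K"
          by (simp add: sum.distrib m_def sum_distrib_left)
        also have "\<dots> \<le> 2 * L * X u + m * K"
          using L G f unfolding X_def
          by (intro add_right_mono mult_left_mono order_trans[OF abs_ge_self Max_ge]) auto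
        finally show ?thesis .
      qed
      then have "Max ((\<lambda>f. \<Sum>i\<in>I. q f (fst u i, snd u i)) ` G) \<le> 2 * L * X u + m * K"
        using G by (intro Max.boundedI) auto
      then show "ennreal (Max ((\<lambda>f. \<Sum>i\<in>I. q f (fst u i, snd u i)) ` G)) \<le> ennreal (2 * L * X u) + ennreal (m * K)"
        using X0 L K by (subst ennreal_plus[symmetric]) (auto simp: m_def simp del: ennreal_plus intro!: ennreal_leI)
    qed
  qed
  also have "\<dots> = (\<integral>\<^sup>+u. ennreal (2 * L * X u) \<partial>P) + ennreal (m * K)"
  proof -
    have "(\<lambda>u. \<Sum>i\<in>I. snd u i * a f (fst u i)) \<in> borel_measurable P" if f: "f \<in> G" for f
    proof (intro borel_measurable_sum)
      fix i assume "i \<in> I"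
      moreover note meas(2)[OF f, measurable]
      moreover have [measurable]: "(\<lambda>s. s) \<in> borel_measurable S" by (simp add: S_def)
      ultimately show "(\<lambda>u. snd u i * a f (fst u i)) \<in> borel_measurable P"
        unfolding P_def by measurable
    qed
    then have [measurable]: "X \<in> borel_measurable P"
      unfolding X_def using G by measurable
    interpret P: prob_space P unfolding P_def
      by (intro prob_space_pair MI.prob_space_axioms SI.prob_space_axioms)
    show ?thesis by (subst nn_integral_add) (auto simp: P.emeasure_space_1)
  qed
  finally have *: "ennreal (D + m * K) \<le> (\<integral>\<^sup>+u. ennreal (2 * L * X u) \<partial>P) + ennreal (m * K)" .
  \<comment> \<open>The shift \<open>m * K\<close> is finite and cancels in the extended reals, even
    if the integral is infinite. A negative \<open>D\<close> is truncated to 0, and nothing remains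
    to be shown.\<close>
  have "ennreal D \<le> (\<integral>\<^sup>+u. ennreal (2 * L * X u) \<partial>P)"
  proof (cases "D \<ge> 0")
    case True
    then have "ennreal D + ennreal (m * K) \<le> (\<integral>\<^sup>+u. ennreal (2 * L * X u) \<partial>P) + ennreal (m * K)"
      using * K by (simp add: m_def)
    then show ?thesis by (simp add: ennreal_add_left_cancel_le add.commute[of _ "ennreal (m * K)"])
  qed (simp add: ennreal_neg)
  then show ?thesis unfolding D_def X_def P_def .
qed

section \<open>Concentration of the empirical mean embedding\<close>

text \<open>Pythagoras for independent centered vectors: integrating out one coordinate kills its
  inner product with the sum of the others. Centering is stated weakly, against each fixed vector,
  because that is all the cross term needs.\<close>

lemma (in prob_space) expectation_norm_sum_square:
  fixes \<psi> :: "'a \<Rightarrow> 'h::{real_inner, second_countable_topology}"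
  assumes "finite J" and [measurable]: "\<psi> \<in> borel_measurable M"
    and bdd: "\<And>x. x \<in> space M \<Longrightarrow> norm (\<psi> x) \<le> C"
    and centered: "\<And>v. expectation (\<lambda>x. v \<bullet> \<psi> x) = 0"
  shows "(\<integral>x. (norm (\<Sum>j\<in>J. \<psi> (x j)))\<^sup>2 \<partial>PiM J (\<lambda>_. M)) = card J * expectation (\<lambda>x. (norm (\<psi> x))\<^sup>2)"
  using assms(1)
proof (induction J rule: finite_induct)
  case empty
  show ?case by simp
next
  case (insert i J)
  interpret MM: product_prob_space "\<lambda>_. M" J by (intro product_prob_spaceI prob_space_axioms)
  interpret iJ: prob_space "PiM (insert i J) (\<lambda>_. M)" by (intro prob_space_PiM prob_space_axioms)
  have meas[measurable]: "(\<lambda>x. \<Sum>j\<in>J. \<psi> (x j)) \<in> borel_measurable (PiM J' (\<lambda>_. M))" if "J \<subseteq> J'" for J J'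
    using that by (intro borel_measurable_sum) (auto, measurable)
  have sum_bdd: "norm (\<Sum>j\<in>J. \<psi> (x j)) \<le> card J * C" if "x \<in> space (PiM J (\<lambda>_. M))" for x J
  proof -
    have "norm (\<Sum>j\<in>J. \<psi> (x j)) \<le> (\<Sum>j\<in>J. norm (\<psi> (x j)))" by (rule norm_sum)
    also have "\<dots> \<le> (\<Sum>j\<in>J. C)" using that by (intro sum_mono bdd) (auto simp: space_PiM)
    finally show ?thesis by simp
  qed
  have int1: "integrable M (\<lambda>y. v \<bullet> \<psi> y)" for v
  proof (intro integrable_const_bound[where B="norm v * C"] AE_I2)
    fix y assume "y \<in> space M"
    then have "norm v * norm (\<psi> y) \<le> norm v * C" by (intro mult_left_mono bdd) auto
    then show "norm (v \<bullet> \<psi> y) \<le> norm v * C"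
      using Cauchy_Schwarz_ineq2[of v "\<psi> y"] by simp
  qed measurable
  have int2: "integrable M (\<lambda>y. (norm (\<psi> y))\<^sup>2)"
    by (intro integrable_const_bound[where B="C\<^sup>2"] AE_I2) (auto intro: bdd power_mono)
  have int3: "integrable (PiM J (\<lambda>_. M)) (\<lambda>x. (norm (\<Sum>j\<in>J. \<psi> (x j)))\<^sup>2)" if "finite J" for J :: "'b set"
  proof -
    interpret J: prob_space "PiM J (\<lambda>_. M)" by (intro prob_space_PiM prob_space_axioms)
    show ?thesis
      by (intro J.integrable_const_bound[where B="(card J * C)\<^sup>2"] AE_I2) (auto intro!: sum_bdd power_mono)
  qed
  have inner: "(\<integral>y. (norm (v + \<psi> y))\<^sup>2 \<partial>M) = (norm v)\<^sup>2 + expectation (\<lambda>x. (norm (\<psi> x))\<^sup>2)" for v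
  proof -
    have "(\<integral>y. (norm (v + \<psi> y))\<^sup>2 \<partial>M) = (\<integral>y. (norm v)\<^sup>2 + 2 * (v \<bullet> \<psi> y) + (norm (\<psi> y))\<^sup>2 \<partial>M)"
      by (intro Bochner_Integration.integral_cong refl)
         (simp add: power2_norm_eq_inner inner_add_left inner_add_right inner_commute)
    also have "\<dots> = (norm v)\<^sup>2 + expectation (\<lambda>x. (norm (\<psi> x))\<^sup>2)"
      using int1 int2 by (simp add: centered prob_space)
    finally show ?thesis .
  qed
  have "(\<integral>x. (norm (\<Sum>j\<in>insert i J. \<psi> (x j)))\<^sup>2 \<partial>PiM (insert i J) (\<lambda>_. M))
      = (\<integral>x. (\<integral>y. (norm (\<Sum>j\<in>insert i J. \<psi> ((x(i := y)) j)))\<^sup>2 \<partial>M) \<partial>PiM J (\<lambda>_. M))"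
    using insert.hyps by (intro MM.product_integral_insert int3) auto
  also have "\<dots> = (\<integral>x. (\<integral>y. (norm ((\<Sum>j\<in>J. \<psi> (x j)) + \<psi> y))\<^sup>2 \<partial>M) \<partial>PiM J (\<lambda>_. M))"
  proof -
    have "(\<Sum>j\<in>J. \<psi> (if j = i then y else x j)) = (\<Sum>j\<in>J. \<psi> (x j))" for x y
      using insert.hyps by (intro sum.cong) auto
    then show ?thesis using insert.hyps by (simp add: add.commute)
  qed
  also have "\<dots> = card (insert i J) * expectation (\<lambda>x. (norm (\<psi> x))\<^sup>2)"
    unfolding inner using insert int3[OF insert.hyps(1)]
    by (simp add: MM.P.prob_space algebra_simps)
  finally show ?case .
qed

context prob_space
begin

context
  fixes Phi :: "'a \<Rightarrow> 'h::{real_inner, complete_space, second_countable_topology}"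
  assumes Phi_meas[measurable]: "Phi \<in> borel_measurable M"
    and Phi_bdd: "\<And>x. x \<in> space M \<Longrightarrow> norm (Phi x) \<le> 1"
begin

lemma integral_inner_kme: "expectation (\<lambda>x. v \<bullet> Phi x) = v \<bullet> kme Phi M"
  unfolding kme_def
  by (intro integral_bounded_linear bounded_linear_inner_right integrable_bounded_complete[OF Phi_meas Phi_bdd])

text \<open>Pairing the embedding with itself turns its squared norm into a scalar expectation,
  which Cauchy-Schwarz bounds by the norm; one factor is then cancelled.\<close>

lemma norm_kme_le: "norm (kme Phi M) \<le> 1"
proof -
  let ?\<mu> = "kme Phi M"
  have "(norm ?\<mu>)\<^sup>2 = expectation (\<lambda>x. ?\<mu> \<bullet> Phi x)"
    by (simp add: integral_inner_kme power2_norm_eq_inner)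
  also have "\<dots> \<le> expectation (\<lambda>x. norm ?\<mu>)"
  proof (rule integral_mono)
    have le: "\<bar>?\<mu> \<bullet> Phi x\<bar> \<le> norm ?\<mu>" if "x \<in> space M" for x
      using order_trans[OF Cauchy_Schwarz_ineq2[of ?\<mu> "Phi x"] mult_left_mono[OF Phi_bdd[OF that] norm_ge_zero[of ?\<mu>]]]
      by simp
    show "integrable M (\<lambda>x. ?\<mu> \<bullet> Phi x)"
      by (intro integrable_const_bound[where B="norm ?\<mu>"] AE_I2) (auto intro: le)
    show "?\<mu> \<bullet> Phi x \<le> norm ?\<mu>" if "x \<in> space M" for x
      using le[OF that] by linarith
  qed simp
  finally have "norm ?\<mu> * norm ?\<mu> \<le> norm ?\<mu> * 1"
    by (simp add: prob_space power2_eq_square)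
  then show ?thesis by (cases "?\<mu> = 0") (auto simp: mult_le_cancel_left)
qed

text \<open>The first summand of the radius bounds the mean of the distance, the second is the
  McDiarmid deviation with differences \<open>2 / m\<close>.\<close>

lemma kme_deviation:
  assumes m: "m > 0" and \<eta>: "0 < \<eta>" "\<eta> < 1"
  shows "emeasure (PiM {..<m} (\<lambda>_. M)) {S \<in> space (PiM {..<m} (\<lambda>_. M)).
      norm (kme_emp Phi m S - kme Phi M)
        \<ge> sqrt (expectation (\<lambda>x. Phi x \<bullet> Phi x) / m) + 2 * sqrt (ln (1 / \<eta>) / (2 * real m))} \<le> ennreal \<eta>"
proof -
  let ?P = "PiM {..<m} (\<lambda>_. M)" and ?\<mu> = "kme Phi M"
  define v where "v = expectation (\<lambda>x. Phi x \<bullet> Phi x)"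
  interpret MM: product_prob_space "\<lambda>_. M" "{..<m}" by (intro product_prob_spaceI prob_space_axioms)
  define Z where "Z S = norm (kme_emp Phi m S - ?\<mu>)" for S
  have [measurable]: "(\<lambda>S. \<Sum>j<m. Phi (S j)) \<in> borel_measurable ?P"
    by (intro borel_measurable_sum) measurable
  have [measurable]: "Z \<in> borel_measurable ?P"
    unfolding Z_def kme_emp_def by measurable
  have emp_bdd: "norm (kme_emp Phi m S) \<le> 1" if S: "S \<in> space ?P" for S
  proof -
    have "norm (\<Sum>j<m. Phi (S j)) \<le> (\<Sum>j<m. norm (Phi (S j)))" by (rule norm_sum)
    also have "\<dots> \<le> (\<Sum>j<m. 1)" using S by (intro sum_mono Phi_bdd) (auto simp: space_PiM)
    finally show ?thesis using m by (simp add: kme_emp_def field_simps)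
  qed
  have Z_bdd: "\<bar>Z S\<bar> \<le> 2" if "S \<in> space ?P" for S
    using norm_triangle_ineq4[of "kme_emp Phi m S" ?\<mu>] emp_bdd[OF that] norm_kme_le by (simp add: Z_def)
  have Z_diff: "\<bar>Z (S(i := y)) - Z S\<bar> \<le> 2 / m" if S: "S \<in> space ?P" and i: "i \<in> {..<m}" and y: "y \<in> space M" for S i y
  proof -
    have "\<bar>Z (S(i := y)) - Z S\<bar> \<le> norm (kme_emp Phi m (S(i := y)) - kme_emp Phi m S)"
      unfolding Z_def by (rule order_trans[OF norm_triangle_ineq3]) simp
    also have "kme_emp Phi m (S(i := y)) - kme_emp Phi m S = (1 / m) *\<^sub>R (Phi y - Phi (S i))"
    proof -
      have "(\<Sum>j<m. Phi ((S(i := y)) j)) = Phi y + (\<Sum>j\<in>{..<m} - {i}. Phi (S j))"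
        using i by (subst sum.remove[of _ i]) (auto intro: sum.cong)
      moreover have "(\<Sum>j<m. Phi (S j)) = Phi (S i) + (\<Sum>j\<in>{..<m} - {i}. Phi (S j))"
        using i by (subst sum.remove[of _ i]) auto
      ultimately show ?thesis by (simp add: kme_emp_def flip: scaleR_diff_right)
    qed
    \<comment> \<open>Both feature vectors lie in the unit ball and can be opposite; this 2 becomes
      the factor of the logarithmic term.\<close>
    also have "norm \<dots> \<le> (1 / m) * 2"
    proof -
      have "S i \<in> space M" using S i by (auto simp: space_PiM)
      then have "norm (Phi y - Phi (S i)) \<le> 2"
        using norm_triangle_ineq4[of "Phi y" "Phi (S i)"] Phi_bdd[OF y] Phi_bdd[of "S i"] by linarith
      then show ?thesis using m by (simp add: divide_right_mono)
    qed
    finally show ?thesis by (simp del: fun_upd_apply)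
  qed
  \<comment> \<open>The exact value is \<open>m\<close> times the variance
    \<open>v - (norm ?\<mu>)\<^sup>2\<close>; discarding the subtracted square leaves the
    expectation of \<open>k z z\<close> that occurs in the theorem.\<close>
  have psi: "(\<integral>S. (norm (\<Sum>j<m. Phi (S j) - ?\<mu>))\<^sup>2 \<partial>?P) \<le> m * v"
  proof -
    have intv: "integrable M (\<lambda>x. w \<bullet> Phi x)" for w
      by (intro integrable_bounded_linear[OF bounded_linear_inner_right] integrable_bounded_complete[OF Phi_meas Phi_bdd])
    have intk: "integrable M (\<lambda>x. Phi x \<bullet> Phi x)"
    proof (intro integrable_const_bound[where B=1] AE_I2)
      fix x assume "x \<in> space M"
      then show "norm (Phi x \<bullet> Phi x) \<le> 1"
        using Phi_bdd[of x] by (simp add: abs_square_le_1 flip: power2_norm_eq_inner)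
    qed measurable
    have "(\<integral>S. (norm (\<Sum>j<m. Phi (S j) - ?\<mu>))\<^sup>2 \<partial>?P) = m * expectation (\<lambda>x. (norm (Phi x - ?\<mu>))\<^sup>2)"
    proof (subst expectation_norm_sum_square[where \<psi>="\<lambda>x. Phi x - ?\<mu>" and C=2])
      show "norm (Phi x - ?\<mu>) \<le> 2" if "x \<in> space M" for x
        using norm_triangle_ineq4[of "Phi x" ?\<mu>] Phi_bdd[OF that] norm_kme_le by linarith
      show "expectation (\<lambda>x. w \<bullet> (Phi x - ?\<mu>)) = 0" for w
        using intv by (simp add: inner_diff_right integral_inner_kme prob_space)
    qed auto
    also have "expectation (\<lambda>x. (norm (Phi x - ?\<mu>))\<^sup>2) = expectation (\<lambda>x. Phi x \<bullet> Phi x - 2 * (?\<mu> \<bullet> Phi x) + (norm ?\<mu>)\<^sup>2)"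
      by (intro Bochner_Integration.integral_cong refl)
         (simp add: power2_norm_eq_inner inner_diff_left inner_diff_right inner_commute)
    also have "\<dots> = v - (norm ?\<mu>)\<^sup>2"
      using intv intk by (simp add: integral_inner_kme prob_space v_def power2_norm_eq_inner)
    also have "real m * (v - (norm ?\<mu>)\<^sup>2) \<le> m * v" by (intro mult_left_mono) auto
    finally show ?thesis by simp
  qed
  have Z_sq: "(Z S)\<^sup>2 = (1 / m\<^sup>2) * (norm (\<Sum>j<m. Phi (S j) - ?\<mu>))\<^sup>2" for S
  proof -
    have "kme_emp Phi m S - ?\<mu> = (1 / m) *\<^sub>R (\<Sum>j<m. Phi (S j) - ?\<mu>)"
      using m by (simp add: kme_emp_def sum_subtractf scaleR_diff_right sum_constant_scaleR)
    then show ?thesis by (simp add: Z_def power_divide)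
  qed
  have intZ: "integrable ?P Z"
    by (intro MM.P.integrable_const_bound[where B=2] AE_I2) (auto intro: Z_bdd)
  have intZ2: "integrable ?P (\<lambda>S. (Z S)\<^sup>2)"
  proof (intro MM.P.integrable_const_bound[where B="2\<^sup>2"] AE_I2)
    show "norm ((Z S)\<^sup>2) \<le> 2\<^sup>2" if "S \<in> space ?P" for S
      using power_mono[OF Z_bdd[OF that] abs_ge_zero, of 2] by simp
  qed measurable
  have EZ: "integral\<^sup>L ?P Z \<le> sqrt (v / m)"
  proof (rule real_le_rsqrt)
    \<comment> \<open>Jensen's inequality for the square, read off from the nonnegativity of the
      variance of \<open>Z\<close>.\<close>
    have "(integral\<^sup>L ?P Z)\<^sup>2 \<le> integral\<^sup>L ?P (\<lambda>S. (Z S)\<^sup>2)"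
      using MM.P.variance_positive[of Z] MM.P.variance_eq[OF intZ intZ2] by simp
    also have "\<dots> = (1 / m\<^sup>2) * (\<integral>S. (norm (\<Sum>j<m. Phi (S j) - ?\<mu>))\<^sup>2 \<partial>?P)"
      unfolding Z_sq by simp
    also have "\<dots> \<le> (1 / m\<^sup>2) * (m * v)" by (intro mult_left_mono psi) auto
    also have "\<dots> = v / m" using m by (simp add: power2_eq_square)
    finally show "(integral\<^sup>L ?P Z)\<^sup>2 \<le> v / m" .
  qed
  define t where "t = 2 * sqrt (ln (1 / \<eta>) / (2 * real m))"
  have ln_pos: "ln (1 / \<eta>) > 0" using \<eta> by (intro ln_gt_zero) (simp add: field_simps)
  have t: "t > 0" using ln_pos m by (simp add: t_def)
  have D: "(\<Sum>i<m. (2 / real m)\<^sup>2) = 4 / m" using m by (simp add: power2_eq_square)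
  have "emeasure ?P {S \<in> space ?P. Z S \<ge> sqrt (v / m) + t} \<le> emeasure ?P {S \<in> space ?P. Z S \<ge> integral\<^sup>L ?P Z + t}"
    using EZ by (intro emeasure_mono) auto
  also have "\<dots> \<le> ennreal (exp (- 2 * t\<^sup>2 / (\<Sum>i<m. (2 / real m)\<^sup>2)))"
    by (rule MM.mcdiarmid[where C=2]) (use Z_bdd Z_diff t m D in auto)
  also have "- 2 * t\<^sup>2 / (\<Sum>i<m. (2 / real m)\<^sup>2) = ln \<eta>"
  proof -
    have "t\<^sup>2 = 4 * (ln (1 / \<eta>) / (2 * real m))"
      unfolding t_def power_mult_distrib using ln_pos m by (subst real_sqrt_pow2) auto
    then show ?thesis using m \<eta> unfolding D by (simp add: ln_div)
  qed
  also have "exp (ln \<eta>) = \<eta>" using \<eta> by simp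
  finally show ?thesis unfolding Z_def t_def v_def .
qed

end

end

section \<open>Measurability and separability\<close>

text \<open>Needed twice, for points within a bag and for the family of bags, to see that the law of
  the samples given the bags is a Markov kernel. Measurability is checked on rectangles, an
  intersection-stable generator on which the product measure is a finite product.\<close>

lemma measurable_PiM_prob_algebra:
  assumes I: "finite I" and K: "\<And>i. i \<in> I \<Longrightarrow> K i \<in> M \<rightarrow>\<^sub>M prob_algebra (N i)"
  shows "(\<lambda>x. PiM I (\<lambda>i. K i x)) \<in> M \<rightarrow>\<^sub>M prob_algebra (PiM I N)"
proof (rule measurable_prob_algebra_generated[OF sets_PiM Int_stable_prod_algebra])
  have K_sp: "K i x \<in> space (prob_algebra (N i))" if "x \<in> space M" "i \<in> I" for x i
    using K[OF that(2)] that(1) by (rule measurable_space)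
  show "prod_algebra I N \<subseteq> Pow (\<Pi>\<^sub>E i\<in>I. space (N i))" by (rule prod_algebra_sets_into_space)
  fix x assume x: "x \<in> space M"
  show "prob_space (PiM I (\<lambda>i. K i x))"
    using K_sp[OF x] by (intro prob_space_PiM) (auto simp: space_prob_algebra)
  show "sets (PiM I (\<lambda>i. K i x)) = sets (PiM I N)"
    using K_sp[OF x] by (intro sets_PiM_cong) (auto simp: space_prob_algebra)
next
  fix A assume "A \<in> prod_algebra I N"
  then obtain X where A: "A = Pi\<^sub>E I X" and X: "\<And>i. i \<in> I \<Longrightarrow> X i \<in> sets (N i)"
    using I by (auto simp: prod_algebra_eq_finite Pi_iff)
  have "emeasure (PiM I (\<lambda>i. K i x)) A = (\<Prod>i\<in>I. emeasure (K i x) (X i))" if x: "x \<in> space M" for x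
  proof -
    have K_sp: "prob_space (K i x)" "sets (K i x) = sets (N i)" if "i \<in> I" for i
      using measurable_space[OF K[OF that] x] by (auto simp: space_prob_algebra)
    have "emeasure (PiM I (\<lambda>i. K i x)) (prod_emb I (\<lambda>i. K i x) I (Pi\<^sub>E I X)) = (\<Prod>i\<in>I. emeasure (K i x) (X i))"
      using I X K_sp by (intro emeasure_PiM_emb) auto
    also have "prod_emb I (\<lambda>i. K i x) I (Pi\<^sub>E I X) = Pi\<^sub>E I X"
      using sets.sets_into_space[OF X] sets_eq_imp_space_eq[OF K_sp(2)]
      by (intro prod_emb_PiE_same_index) auto
    finally show ?thesis by (simp add: A)
  qed
  moreover have "(\<lambda>x. \<Prod>i\<in>I. emeasure (K i x) (X i)) \<in> borel_measurable M"
    using K X by (intro borel_measurable_prod_ennreal)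
      (auto intro!: measurable_compose[OF measurable_prob_algebraD[OF K] measurable_emeasure_subprob_algebra])
  ultimately show "(\<lambda>x. emeasure (PiM I (\<lambda>i. K i x)) A) \<in> borel_measurable M"
    by (simp cong: measurable_cong)
qed

text \<open>This makes suprema over an uncountable Lipschitz class measurable.\<close>

lemma lipschitz_class_separable:
  fixes F :: "('h::{metric_space, second_countable_topology} \<Rightarrow> real) set"
  assumes lip: "\<And>f. f \<in> F \<Longrightarrow> L-lipschitz_on UNIV f"
  obtains F0 where "countable F0" "F0 \<subseteq> F"
    "\<And>f. f \<in> F \<Longrightarrow> \<exists>g. (\<forall>k. g k \<in> F0) \<and> (\<forall>h. (\<lambda>k. g k h) \<longlonglongrightarrow> f h)"
proof -
  obtain D :: "'h set" where D: "countable D" "UNIV \<subseteq> closure D" by (rule separable[of UNIV])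
  have "D \<noteq> {}" using D(2) by auto
  define d where "d = from_nat_into D"
  have d: "range d = D" unfolding d_def using D(1) \<open>D \<noteq> {}\<close> by (simp add: range_from_nat_into)
  \<comment> \<open>Restriction to a dense sequence maps \<open>F\<close> into a countable product
    of real lines. That space is second countable, so the image has a countable dense subset, which
    \<open>S\<close> lifts back to \<open>F\<close>.\<close>
  define T where "T f = (\<lambda>j. f (d j))" for f :: "'h \<Rightarrow> real"
  obtain T0 where T0: "countable T0" "T0 \<subseteq> T ` F" "T ` F \<subseteq> closure T0" by (rule separable[of "T ` F"])
  define S where "S = inv_into F T"
  have S: "S t \<in> F" "T (S t) = t" if "t \<in> T0" for t
  proof -
    have "t \<in> T ` F" using that T0(2) by auto
    then show "S t \<in> F" "T (S t) = t" unfolding S_def by (rule inv_into_into, rule f_inv_into_f)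
  qed
  show thesis
  proof (rule that[of "S ` T0"])
    show "countable (S ` T0)" "S ` T0 \<subseteq> F" using T0(1) S by auto
    fix f assume f: "f \<in> F"
    then have "T f \<in> closure T0" using T0(3) by auto
    then obtain x where x: "\<And>k. x k \<in> T0" "x \<longlonglongrightarrow> T f" unfolding closure_sequential by auto
    have D_lim: "(\<lambda>k. S (x k) y) \<longlonglongrightarrow> f y" if "y \<in> D" for y
    proof -
      have "y \<in> range d" using that d by simp
      then obtain j where j: "y = d j" by auto
      have "continuous_on UNIV (\<lambda>t :: nat \<Rightarrow> real. t j)" by (rule continuous_on_product_coordinates)
      then have "(\<lambda>k. x k j) \<longlonglongrightarrow> T f j"
        by (rule continuous_on_tendsto_compose) (use x in auto)
      moreover have "x k j = S (x k) y" for k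
        using fun_cong[OF S(2)[OF x(1)], of k j] by (simp add: T_def j)
      ultimately show ?thesis by (simp add: T_def j)
    qed
    have "(\<lambda>k. S (x k) h) \<longlonglongrightarrow> f h" for h
    proof (rule LIMSEQ_I)
      fix e :: real assume e: "0 < e"
      have L: "L \<ge> 0" using lip[OF f] by (rule lipschitz_on_nonneg)
      \<comment> \<open>The error is split into three parts: moving from \<open>h\<close> to
        \<open>y\<close> under each of the two functions, and the convergence at \<open>y\<close>.
        Adding 1 to \<open>L\<close> avoids division by zero when \<open>L = 0\<close>.\<close>
      define r where "r = e / (3 * (L + 1))"
      have r: "r > 0" using e L by (simp add: r_def)
      have Lr: "L * r < e / 3"
      proof -
        have "L * r < (L + 1) * r" using r by simp
        also have "\<dots> = e / 3"
        proof -
          have "L + 1 \<noteq> 0" using L by linarith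
          then show ?thesis unfolding r_def by (simp add: divide_simps)
        qed
        finally show ?thesis .
      qed
      have "h \<in> closure D" using D(2) by auto
      then obtain y where y: "y \<in> D" "dist y h < r" using r by (auto simp: closure_approachable)
      have near: "\<bar>g h - g y\<bar> \<le> L * r" if "g \<in> F" for g
      proof -
        have "L * dist h y \<le> L * r" using y(2) L by (intro mult_left_mono) (auto simp: dist_commute)
        then show ?thesis using lipschitz_onD[OF lip[OF that], of h y] by (simp add: dist_real_def)
      qed
      obtain N where N: "\<And>k. k \<ge> N \<Longrightarrow> \<bar>S (x k) y - f y\<bar> < e / 3"
        using LIMSEQ_D[OF D_lim[OF y(1)], of "e / 3"] e by auto
      have "norm (S (x k) h - f h) < e" if "k \<ge> N" for k
        using N[OF that] near[OF f] near[OF S(1)[OF x(1)], of k] Lr by (simp, linarith)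
      then show "\<exists>N. \<forall>k\<ge>N. norm (S (x k) h - f h) < e" by blast
    qed
    then show "\<exists>g. (\<forall>k. g k \<in> S ` T0) \<and> (\<forall>h. (\<lambda>k. g k h) \<longlonglongrightarrow> f h)"
      using x(1) by (intro exI[of _ "\<lambda>k. S (x k)"]) auto
  qed
qed

section \<open>The two-stage bound\<close>

lemma abs_Max_image_diff_le:
  fixes h h' :: "'f \<Rightarrow> real"
  assumes G: "finite G" "G \<noteq> {}" and c: "\<And>f. f \<in> G \<Longrightarrow> \<bar>h f - h' f\<bar> \<le> c"
  shows "\<bar>Max (h ` G) - Max (h' ` G)\<bar> \<le> c"
proof -
  have "Max (u ` G) \<le> Max (v ` G) + c" if "\<And>f. f \<in> G \<Longrightarrow> u f \<le> v f + c" for u v :: "'f \<Rightarrow> real"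
  proof -
    have "Max (u ` G) \<le> Max ((\<lambda>f. v f + c) ` G)" by (intro Max_image_mono G that)
    then show ?thesis using G by (simp add: Max_add_commute)
  qed
  from this[of h h'] this[of h' h] c show ?thesis by (auto simp: abs_le_iff algebra_simps)
qed

text \<open>Here \<open>g\<close> is the fixed reference function, to be taken as
  \<open>fstar\<close>. Since the differences of \<open>dev f - dev g\<close> are bounded by
  \<open>2 * B / n\<close>, the McDiarmid deviation at level \<open>\<eta>\<close> is the second
  summand of the threshold; \<open>r\<close> bounds the mean of the supremum.\<close>

lemma (in prob_space) uniform_deviation:
  fixes loss a :: "'f \<Rightarrow> 'a \<Rightarrow> real" and n :: nat
  defines "S \<equiv> measure_pmf (pmf_of_set {-1, 1::real})"
  defines "dev \<equiv> \<lambda>f x. expectation (loss f) - (1 / n) * (\<Sum>i<n. loss f (x i))"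
  assumes n: "n > 0" and F0: "countable F0" and L: "L \<ge> 0" and B: "B > 0" and \<eta>: "0 < \<eta>" "\<eta> < 1"
    and meas: "\<And>f. f \<in> insert g F0 \<Longrightarrow> loss f \<in> borel_measurable M" "\<And>f. f \<in> F0 \<Longrightarrow> a f \<in> borel_measurable M"
    and loss_bdd: "\<And>f x. f \<in> insert g F0 \<Longrightarrow> x \<in> space M \<Longrightarrow> loss f x \<in> {0..B}"
    and a_bdd: "\<And>f. f \<in> F0 \<Longrightarrow> \<exists>C. \<forall>x\<in>space M. \<bar>a f x\<bar> \<le> C"
    and contr: "\<And>f g x. f \<in> F0 \<Longrightarrow> g \<in> F0 \<Longrightarrow> x \<in> space M \<Longrightarrow> \<bar>loss f x - loss g x\<bar> \<le> L * \<bar>a f x - a g x\<bar>"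
    and r: "r \<ge> 0"
    and rad: "ennreal (2 * L) * (\<integral>\<^sup>+u. (SUP f\<in>F0. ennreal \<bar>(1 / n) * (\<Sum>i<n. snd u i * a f (fst u i))\<bar>)
          \<partial>(PiM {..<n} (\<lambda>_. M) \<Otimes>\<^sub>M PiM {..<n} (\<lambda>_. S))) \<le> ennreal r"
  defines "Bad \<equiv> {x \<in> space (PiM {..<n} (\<lambda>_. M)). \<exists>f\<in>F0. dev f x - dev g x > r + 2 * B * sqrt (ln (1 / \<eta>) / (2 * real n))}"
  shows "Bad \<in> sets (PiM {..<n} (\<lambda>_. M)) \<and> emeasure (PiM {..<n} (\<lambda>_. M)) Bad \<le> ennreal \<eta>"
proof (cases "F0 = {}")
  case False
  let ?P = "PiM {..<n} (\<lambda>_. M)"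
  let ?Q = "?P \<Otimes>\<^sub>M PiM {..<n} (\<lambda>_. S)"
  interpret MM: product_prob_space "\<lambda>_. M" "{..<n}" by (intro product_prob_spaceI prob_space_axioms)
  define t where "t = 2 * B * sqrt (ln (1 / \<eta>) / (2 * real n))"
  have ln_pos: "ln (1 / \<eta>) > 0" using \<eta> by (intro ln_gt_zero) (simp add: field_simps)
  have t: "t > 0" using ln_pos n B by (simp add: t_def)
  have in_space: "x i \<in> space M" if "x \<in> space ?P" "i < n" for x i
    using that by (auto simp: space_PiM)
  have int_loss: "integrable M (loss f)" if "f \<in> insert g F0" for f
    using that by (intro integrable_const_bound[where B=B] AE_I2) (use meas loss_bdd in auto)
  have meas_i[measurable]: "(\<lambda>x. \<Sum>i<n. loss f (x i)) \<in> borel_measurable ?P" if "f \<in> insert g F0" for f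
  proof (intro borel_measurable_sum)
    fix i assume "i \<in> {..<n}"
    moreover note meas(1)[OF that, measurable]
    ultimately show "(\<lambda>x. loss f (x i)) \<in> borel_measurable ?P" by measurable
  qed
  have dev_meas[measurable]: "dev f \<in> borel_measurable ?P" if "f \<in> insert g F0" for f
    unfolding dev_def using that by measurable
  have E_bdd: "expectation (loss f) \<in> {0..B}" if f: "f \<in> insert g F0" for f
  proof -
    have "expectation (loss f) \<le> (\<integral>x. B \<partial>M)"
      using loss_bdd[OF f] by (intro integral_mono int_loss f) auto
    moreover have "0 \<le> expectation (loss f)"
      using loss_bdd[OF f] by (intro integral_nonneg_AE AE_I2) auto
    ultimately show ?thesis by (simp add: prob_space)
  qed
  have dev_bdd: "\<bar>dev f x\<bar> \<le> B" if f: "f \<in> insert g F0" and x: "x \<in> space ?P" for f x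
  proof -
    have "(\<Sum>i<n. loss f (x i)) \<le> (\<Sum>i<n. B)"
      using loss_bdd[OF f in_space[OF x]] by (intro sum_mono) auto
    then have "(1 / n) * (\<Sum>i<n. loss f (x i)) \<le> B" using n by (simp add: field_simps)
    moreover have "0 \<le> (1 / n) * (\<Sum>i<n. loss f (x i))"
      using loss_bdd[OF f in_space[OF x]] by (intro mult_nonneg_nonneg sum_nonneg) auto
    ultimately show ?thesis using E_bdd[OF f] by (auto simp: dev_def abs_le_iff)
  qed
  have dev_diff: "\<bar>dev f (x(i := y)) - dev f x\<bar> \<le> B / n"
    if f: "f \<in> insert g F0" and x: "x \<in> space ?P" and i: "i < n" and y: "y \<in> space M" for f x i y
  proof -
    have "(\<Sum>j<n. loss f ((x(i := y)) j)) = loss f y + (\<Sum>j\<in>{..<n} - {i}. loss f (x j))"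
      using i by (subst sum.remove[of _ i]) (auto intro: sum.cong)
    moreover have "(\<Sum>j<n. loss f (x j)) = loss f (x i) + (\<Sum>j\<in>{..<n} - {i}. loss f (x j))"
      using i by (subst sum.remove[of _ i]) auto
    ultimately have "dev f (x(i := y)) - dev f x = (1 / n) * (loss f (x i) - loss f y)"
      by (simp add: dev_def algebra_simps add_divide_distrib)
    moreover have "\<bar>loss f (x i) - loss f y\<bar> \<le> B"
      using loss_bdd[OF f in_space[OF x i]] loss_bdd[OF f y] by auto
    ultimately show ?thesis using n by (simp add: abs_mult divide_right_mono)
  qed
  have int_dev: "integrable ?P (dev f)" if "f \<in> insert g F0" for f
    using dev_bdd[OF that] that by (intro MM.P.integrable_const_bound[where B=B] AE_I2) auto
  have E_dev_g: "integral\<^sup>L ?P (dev g) = 0"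
  proof -
    have comp: "integral\<^sup>L ?P (\<lambda>x. loss g (x i)) = expectation (loss g)" if i: "i < n" for i
    proof -
      have "expectation (loss g) = integral\<^sup>L (distr ?P M (\<lambda>x. x i)) (loss g)"
        using i by (subst distr_PiM_component) (auto intro: prob_space_axioms)
      also have "\<dots> = integral\<^sup>L ?P (\<lambda>x. loss g (x i))"
        using i meas(1)[of g] by (intro integral_distr) auto
      finally show ?thesis by simp
    qed
    have int: "integrable ?P (\<lambda>x. loss g (x i))" if i: "i < n" for i
    proof (intro MM.P.integrable_const_bound[where B=B] AE_I2)
      show "norm (loss g (x i)) \<le> B" if "x \<in> space ?P" for x
        using loss_bdd[of g "x i"] in_space[OF that i] by auto
      show "(\<lambda>x. loss g (x i)) \<in> borel_measurable ?P"
        using measurable_compose[OF measurable_component_singleton[of i "{..<n}" "\<lambda>_. M"] meas(1)[of g]] i by simp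
    qed
    have "integrable ?P (\<lambda>x. \<Sum>i<n. loss g (x i))"
      using int by (intro Bochner_Integration.integrable_sum) auto
    with int have "integral\<^sup>L ?P (dev g) = expectation (loss g) - (1 / n) * (\<Sum>i<n. integral\<^sup>L ?P (\<lambda>x. loss g (x i)))"
      unfolding dev_def
      by (subst Bochner_Integration.integral_diff) (simp_all add: MM.P.prob_space Bochner_Integration.integral_sum)
    also have "\<dots> = 0" using n by (simp add: comp)
    finally show ?thesis .
  qed
  have fin: "emeasure ?P {x \<in> space ?P. Max ((\<lambda>f. dev f x - dev g x) ` G) > r + t} \<le> ennreal \<eta>"
    if G: "finite G" "G \<noteq> {}" "G \<subseteq> F0" for G
  proof -
    define H where "H x = Max ((\<lambda>f. dev f x - dev g x) ` G)" for x
    have [measurable]: "H \<in> borel_measurable ?P"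
      unfolding H_def using G by (intro borel_measurable_Max) (auto intro!: borel_measurable_diff dev_meas)
    have H_bdd: "\<bar>H x\<bar> \<le> 2 * B" if "x \<in> space ?P" for x
      unfolding H_def using G dev_bdd[OF _ that]
      by (intro abs_Max_image_le) (auto simp: abs_le_iff, (smt (verit) insertCI subsetD)+)
    have H_diff: "\<bar>H (x(i := y)) - H x\<bar> \<le> 2 * B / n" if "x \<in> space ?P" "i \<in> {..<n}" "y \<in> space M" for x i y
      unfolding H_def
    proof (rule abs_Max_image_diff_le[OF G(1,2)])
      fix f assume "f \<in> G"
      then have "\<bar>dev f (x(i := y)) - dev f x\<bar> \<le> B / n" "\<bar>dev g (x(i := y)) - dev g x\<bar> \<le> B / n"
        using that G by (auto intro!: dev_diff simp del: fun_upd_apply)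
      then show "\<bar>dev f (x(i := y)) - dev g (x(i := y)) - (dev f x - dev g x)\<bar> \<le> 2 * B / n"
        by (simp add: abs_le_iff)
    qed
    have Max_dev_meas[measurable]: "(\<lambda>x. Max ((\<lambda>f. dev f x) ` G)) \<in> borel_measurable ?P"
      using G by (intro borel_measurable_Max) (auto intro!: dev_meas)
    have int_Max: "integrable ?P (\<lambda>x. Max ((\<lambda>f. dev f x) ` G))"
      using G by (intro MM.P.integrable_const_bound[where B=B] AE_I2) (auto intro!: abs_Max_image_le dev_bdd)
    have EH: "integral\<^sup>L ?P H \<le> r"
    proof -
      \<comment> \<open>\<open>dev g\<close> does not vary with the index of the maximum, so it
        leaves the maximum and then vanishes in expectation.\<close>
      have "H = (\<lambda>x. Max ((\<lambda>f. dev f x) ` G) - dev g x)"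
        unfolding H_def using Max_add_commute[OF G(1,2), of "\<lambda>f. dev f x" "- dev g x" for x] by simp
      then have EH: "integral\<^sup>L ?P H = (\<integral>x. Max ((\<lambda>f. dev f x) ` G) \<partial>?P)"
        using int_Max int_dev[of g] by (simp add: E_dev_g)
      \<comment> \<open>Each \<open>a f\<close> has its own bound; only on a finite class is there a
        common one. It is harmless that it grows with \<open>G\<close>, since it does not occur in
        the conclusion of \<open>expected_sup_deviation_le\<close>.\<close>
      have "\<exists>C. \<forall>f\<in>G. \<forall>x\<in>space M. \<bar>a f x\<bar> \<le> C"
      proof -
        have "\<forall>f\<in>G. \<exists>C. \<forall>x\<in>space M. \<bar>a f x\<bar> \<le> C" using a_bdd G by blast
        then obtain c where c: "\<And>f x. f \<in> G \<Longrightarrow> x \<in> space M \<Longrightarrow> \<bar>a f x\<bar> \<le> c f" by metis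
        have "\<bar>a f x\<bar> \<le> Max (c ` G)" if "f \<in> G" "x \<in> space M" for f x
          using G that by (intro order_trans[OF c Max_ge]) auto
        then show ?thesis by blast
      qed
      then obtain C where C: "\<And>f x. f \<in> G \<Longrightarrow> x \<in> space M \<Longrightarrow> \<bar>a f x\<bar> \<le> C" by blast
      let ?sup = "\<lambda>u. SUP f\<in>F0. ennreal \<bar>(1 / n) * (\<Sum>i<n. snd u i * a f (fst u i))\<bar>"
      have "(\<lambda>u. \<Sum>i<n. snd u i * a f (fst u i)) \<in> borel_measurable ?Q" if f: "f \<in> F0" for f
      proof (intro borel_measurable_sum)
        fix i assume "i \<in> {..<n}"
        moreover note meas(2)[OF f, measurable]
        moreover have [measurable]: "(\<lambda>s. s) \<in> borel_measurable S" by (simp add: S_def)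
        ultimately show "(\<lambda>u. snd u i * a f (fst u i)) \<in> borel_measurable ?Q" by measurable
      qed
      then have sup_meas: "?sup \<in> borel_measurable ?Q"
        using F0 by (intro borel_measurable_SUP) auto
      have "Max ((\<lambda>f. \<Sum>i<n. expectation (loss f) - loss f (x i)) ` G) = n * Max ((\<lambda>f. dev f x) ` G)" for x
      proof -
        have "(\<Sum>i<n. expectation (loss f) - loss f (x i)) = n * dev f x" for f
          using n by (simp add: dev_def sum_subtractf field_simps)
        then show ?thesis
          using mono_Max_commute[of "\<lambda>y. real n * y" "(\<lambda>f. dev f x) ` G"] G
          by (simp add: image_image mono_def mult_left_mono)
      qed
      then have "ennreal (n * integral\<^sup>L ?P H)
          = ennreal (\<integral>x. Max ((\<lambda>f. \<Sum>i<n. expectation (loss f) - loss f (x i)) ` G) \<partial>?P)"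
        by (simp add: EH)
      also have "\<dots> \<le> (\<integral>\<^sup>+u. ennreal (2 * L * Max ((\<lambda>f. \<bar>\<Sum>i<n. snd u i * a f (fst u i)\<bar>) ` G)) \<partial>?Q)"
        unfolding S_def
      proof (rule expected_sup_deviation_le[OF _ G(1,2) L, where C="max B C"])
        show "\<bar>loss f x\<bar> \<le> max B C" "\<bar>a f x\<bar> \<le> max B C" if "f \<in> G" "x \<in> space M" for f x
          using loss_bdd[of f x] C[OF that] that G by (auto simp: le_max_iff_disj)
        show "loss f \<in> borel_measurable M" "a f \<in> borel_measurable M" if "f \<in> G" for f
          using meas that G by auto
        show "\<bar>loss f x - loss h x\<bar> \<le> L * \<bar>a f x - a h x\<bar>" if "f \<in> G" "h \<in> G" "x \<in> space M" for f h x
          using that G by (intro contr) auto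
      qed simp
      also have "\<dots> \<le> (\<integral>\<^sup>+u. ennreal n * (ennreal (2 * L) * ?sup u) \<partial>?Q)"
      proof (rule nn_integral_mono)
        fix u :: "(nat \<Rightarrow> 'a) \<times> (nat \<Rightarrow> real)"
        have "Max ((\<lambda>f. \<bar>\<Sum>i<n. snd u i * a f (fst u i)\<bar>) ` G) \<in> (\<lambda>f. \<bar>\<Sum>i<n. snd u i * a f (fst u i)\<bar>) ` G"
          using G by (intro Max_in) auto
        then obtain f where f: "f \<in> G"
          and Max_f: "Max ((\<lambda>f. \<bar>\<Sum>i<n. snd u i * a f (fst u i)\<bar>) ` G) = \<bar>\<Sum>i<n. snd u i * a f (fst u i)\<bar>" by auto
        have "ennreal (2 * L * \<bar>\<Sum>i<n. snd u i * a f (fst u i)\<bar>)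
            = ennreal n * (ennreal (2 * L) * ennreal \<bar>(1 / n) * (\<Sum>i<n. snd u i * a f (fst u i))\<bar>)"
          using n L by (simp add: abs_mult flip: ennreal_mult)
        also have "\<dots> \<le> ennreal n * (ennreal (2 * L) * ?sup u)"
          using f G by (intro mult_left_mono SUP_upper) auto
        finally show "ennreal (2 * L * Max ((\<lambda>f. \<bar>\<Sum>i<n. snd u i * a f (fst u i)\<bar>) ` G))
            \<le> ennreal n * (ennreal (2 * L) * ?sup u)" unfolding Max_f .
      qed
      also have "\<dots> = ennreal n * (ennreal (2 * L) * (\<integral>\<^sup>+u. ?sup u \<partial>?Q))"
        using sup_meas by (simp add: nn_integral_cmult)
      also have "\<dots> \<le> ennreal n * ennreal r" by (intro mult_left_mono rad) auto
      also have "\<dots> = ennreal (n * r)" using r by (simp add: ennreal_mult)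
      finally have "n * integral\<^sup>L ?P H \<le> n * r" using r by (subst (asm) ennreal_le_iff) auto
      then show ?thesis using n by simp
    qed
    have D: "(\<Sum>i<n. (2 * B / n)\<^sup>2) = 4 * B\<^sup>2 / n" using n by (simp add: power2_eq_square)
    have "emeasure ?P {x \<in> space ?P. H x > r + t} \<le> emeasure ?P {x \<in> space ?P. H x \<ge> integral\<^sup>L ?P H + t}"
      using EH by (intro emeasure_mono) auto
    also have "\<dots> \<le> ennreal (exp (- 2 * t\<^sup>2 / (\<Sum>i<n. (2 * B / n)\<^sup>2)))"
      by (rule MM.mcdiarmid[where C="2 * B"]) (use H_bdd H_diff t n B D in auto)
    also have "- 2 * t\<^sup>2 / (\<Sum>i<n. (2 * B / n)\<^sup>2) = ln \<eta>"
    proof -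
      have "t\<^sup>2 = 4 * B\<^sup>2 * (ln (1 / \<eta>) / (2 * real n))"
        unfolding t_def power_mult_distrib using ln_pos n by (subst real_sqrt_pow2) auto
      then show ?thesis using n \<eta> B unfolding D by (simp add: ln_div)
    qed
    also have "exp (ln \<eta>) = \<eta>" using \<eta> by simp
    finally show ?thesis unfolding H_def .
  qed
  \<comment> \<open>An increasing exhaustion of \<open>F0\<close> by finite classes. The bound
    \<open>fin\<close> is the same for all of them, so continuity from below carries it to
    \<open>Bad\<close>.\<close>
  define G where "G m = from_nat_into F0 ` {..m}" for m
  have G: "finite (G m)" "G m \<noteq> {}" "G m \<subseteq> F0" for m
    using False by (auto simp: G_def intro: from_nat_into)
  define A where "A m = {x \<in> space ?P. Max ((\<lambda>f. dev f x - dev g x) ` G m) > r + t}" for m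
  have A_alt: "A m = {x \<in> space ?P. \<exists>f\<in>G m. dev f x - dev g x > r + t}" for m
    unfolding A_def using G[of m] by (auto simp: Max_gr_iff)
  have "F0 = (\<Union>m. from_nat_into F0 ` {..m})"
    using range_from_nat_into[OF False F0] by (simp add: UN_atMost_UNIV flip: image_UN)
  then have "F0 = (\<Union>m. G m)" unfolding G_def .
  then have Bad_eq: "Bad = (\<Union>m. A m)" unfolding A_alt Bad_def t_def[symmetric] by auto
  have dev_sets: "{x \<in> space ?P. dev f x - dev g x > r + t} \<in> sets ?P" if "f \<in> F0" for f
  proof -
    have [measurable]: "dev f \<in> borel_measurable ?P" "dev g \<in> borel_measurable ?P" using that by auto
    show ?thesis by measurable
  qed
  have A_sets: "range A \<subseteq> sets ?P"
    unfolding A_alt using G(1) subsetD[OF G(3)] by (auto intro!: sets.sets_Collect_finite_Ex dev_sets)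
  moreover have "incseq A" unfolding A_alt G_def by (fastforce simp: incseq_def)
  ultimately have "emeasure ?P Bad = (SUP m. emeasure ?P (A m))"
    unfolding Bad_eq by (rule SUP_emeasure_incseq[symmetric])
  also have "\<dots> \<le> ennreal \<eta>" unfolding A_def by (intro SUP_least fin G)
  finally show ?thesis using A_sets unfolding Bad_eq by blast
qed (simp add: Bad_def)

text \<open>The squared distance of \<open>Phi z\<close> and \<open>Phi x\<close> is
  \<open>k z z - 2 * k z x + k x x\<close>, a continuous function of \<open>z\<close> that vanishes
  at \<open>x\<close>.\<close>

lemma continuous_feature_map:
  fixes k :: "'z::topological_space \<Rightarrow> 'z \<Rightarrow> real" and Phi :: "'z \<Rightarrow> 'h::real_inner"
  assumes k: "\<And>z z'. k z z' = Phi z \<bullet> Phi z'"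
    and cont: "continuous_on UNIV (\<lambda>p. k (fst p) (snd p))"
  shows "continuous_on UNIV Phi"
  unfolding continuous_on_def
proof
  fix x
  have diag: "continuous_on UNIV (\<lambda>z. k z z)"
    using continuous_on_compose2[OF cont, of UNIV "\<lambda>z. (z, z)"] by (simp add: continuous_on_Pair)
  have slice: "continuous_on UNIV (\<lambda>z. k z x)"
    using continuous_on_compose2[OF cont, of UNIV "\<lambda>z. (z, x)"] by (simp add: continuous_on_Pair)
  have "continuous_on UNIV (\<lambda>z. sqrt (k z z - 2 * k z x + k x x))"
    by (intro continuous_intros diag slice)
  then have "((\<lambda>z. sqrt (k z z - 2 * k z x + k x x)) \<longlongrightarrow> sqrt (k x x - 2 * k x x + k x x)) (at x)"
    unfolding continuous_on_def by blast
  moreover have "(\<lambda>z. sqrt (k z z - 2 * k z x + k x x)) = (\<lambda>z. dist (Phi z) (Phi x))"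
    by (simp add: fun_eq_iff k dist_norm norm_eq_sqrt_inner inner_diff_left inner_diff_right inner_commute)
  moreover have "sqrt (k x x - 2 * k x x + k x x) = 0" by simp
  ultimately have "((\<lambda>z. dist (Phi z) (Phi x)) \<longlongrightarrow> 0) (at x)" by (simp only:)
  then show "(Phi \<longlongrightarrow> Phi x) (at x within UNIV)" by (rule tendsto_dist_iff[THEN iffD2])
qed

theorem theorem6p2:
  fixes k :: "'z::topological_space \<Rightarrow> 'z \<Rightarrow> real"
    and Phi :: "'z \<Rightarrow> 'h::{real_inner,complete_space,second_countable_topology}"
    and M :: "('z measure \<times> real) measure"
    and n :: nat and ns :: "nat \<Rightarrow> nat"
    and F :: "('h \<Rightarrow> real) set"
    and L_F L_phi B \<delta> :: real
    and \<phi> :: "real \<Rightarrow> real"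
    and fstar :: "'h \<Rightarrow> real"
    and ftil :: "(nat \<Rightarrow> 'z measure \<times> real) \<times> (nat \<Rightarrow> nat \<Rightarrow> 'z) \<Rightarrow> 'h \<Rightarrow> real"
  assumes separable: "separable_space (euclidean :: 'z topology)"
    and feature: "\<And>z z'. k z z' = inner (Phi z) (Phi z')"
    and rkhs_dense: "closure (span (range Phi)) = UNIV"
    and k_cont: "continuous_on UNIV (\<lambda>p. k (fst p) (snd p))"
    and k_bound: "\<And>z. k z z \<le> 1"
    and k_char: "characteristic Phi"
    and M_prob: "prob_space M"
    and M_sets: "sets M = sets (prob_algebra (borel :: 'z measure) \<Otimes>\<^sub>M count_space {-1, 1::real})"
    and n_pos: "n > 0"
    and ns_pos: "\<And>i. i < n \<Longrightarrow> ns i > 0"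
    and F_lip: "\<And>f. f \<in> F \<Longrightarrow> L_F-lipschitz_on UNIV f"
    and phi_nonneg: "\<And>x. \<phi> x \<ge> 0"
    and phi_lip: "L_phi-lipschitz_on UNIV \<phi>"
    and phi_ind: "\<And>x. \<phi> x \<ge> (if x > 0 then 1 else 0)"
    and phi_B: "\<And>f h l. f \<in> F \<Longrightarrow> l \<in> {-1, 1} \<Longrightarrow> \<phi> (- f h * l) \<le> B"
    and F_meas: "\<And>f. f \<in> F \<Longrightarrow> (\<lambda>Pl. f (kme Phi (fst Pl))) \<in> borel_measurable M"
    and rad_meas: "rademacher_integrand Phi F n \<in> borel_measurable (bag_space M n \<Otimes>\<^sub>M rademacher_signs n)"
    and fstar_in: "fstar \<in> F"
    and fstar_min: "\<And>f. f \<in> F \<Longrightarrow> risk \<phi> M Phi fstar \<le> risk \<phi> M Phi f"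
    and ftil_in: "\<And>\<omega>. \<omega> \<in> space (sample_space M n ns) \<Longrightarrow> ftil \<omega> \<in> F"
    and ftil_min: "\<And>\<omega> f. \<omega> \<in> space (sample_space M n ns) \<Longrightarrow> f \<in> F \<Longrightarrow>
                     emp_risk \<phi> n ns Phi \<omega> (ftil \<omega>) \<le> emp_risk \<phi> n ns Phi \<omega> f"
    and ftil_meas: "(\<lambda>\<omega>. risk \<phi> M Phi (ftil \<omega>)) \<in> borel_measurable (sample_space M n ns)"
    and delta: "0 < \<delta>" "\<delta> < 1"
  shows "measure (sample_space M n ns)
           {\<omega> \<in> space (sample_space M n ns).
              ennreal (risk \<phi> M Phi (ftil \<omega>) - risk \<phi> M Phi fstar)
              \<le> ennreal (4 * L_phi) * rademacher_complexity M Phi F n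
                 + ennreal (2 * B * sqrt (ln (2 / \<delta>) / (2 * real n))
                   + 4 * L_phi * L_F / real n *
                     (\<Sum>i<n. sqrt ((\<integral>z. k z z \<partial>(fst (fst \<omega> i))) / real (ns i))
                            + sqrt (ln (2 * real n / \<delta>) / (2 * real (ns i)))))}
         \<ge> 1 - \<delta>"
proof -
  define \<Omega> where "\<Omega> = sample_space M n ns"
  define bag where "bag = bag_space M n"
  define N where "N = (\<Pi>\<^sub>M i\<in>{..<n}. \<Pi>\<^sub>M j\<in>{..<ns i}. (borel :: 'z measure))"
  define Q where "Q pls = (\<Pi>\<^sub>M i\<in>{..<n}. \<Pi>\<^sub>M j\<in>{..<ns i}. fst (pls i))" for pls :: "nat \<Rightarrow> 'z measure \<times> real"
  \<comment> \<open>The kernel keeps the bags as first component, so that mixing it over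
    \<open>bag\<close> gives the joint law of bags and samples.\<close>
  define K where "K pls = distr (Q pls) (bag \<Otimes>\<^sub>M N) (\<lambda>S. (pls, S))" for pls
  define loss where "loss f pl = \<phi> (- f (kme Phi (fst pl)) * snd pl)" for f :: "'h \<Rightarrow> real" and pl :: "'z measure \<times> real"
  define a where "a f pl = f (kme Phi (fst pl))" for f :: "'h \<Rightarrow> real" and pl :: "'z measure \<times> real"
  define dev where "dev f pls = integral\<^sup>L M (loss f) - (1 / real n) * (\<Sum>i<n. loss f (pls i))" for f pls
  interpret M: prob_space M by (rule M_prob)
  have bag_PiM: "bag = PiM {..<n} (\<lambda>_. M)" by (simp add: bag_def bag_space_def)
  interpret bag: prob_space bag unfolding bag_PiM by (intro prob_space_PiM M_prob)

  \<comment> \<open>Measurability, boundedness and Lipschitz estimates for the losses\<close>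
  have M_space: "prob_space (fst pl)" "sets (fst pl) = sets borel" "snd pl \<in> {-1, 1}" if "pl \<in> space M" for pl
    using that sets_eq_imp_space_eq[OF M_sets] by (auto simp: space_pair_measure space_prob_algebra)
  have fst_M[measurable]: "fst \<in> M \<rightarrow>\<^sub>M prob_algebra borel"
    unfolding measurable_cong_sets[OF M_sets refl] by (rule measurable_fst)
  have snd_M[measurable]: "snd \<in> borel_measurable M"
    unfolding measurable_cong_sets[OF M_sets refl]
    by (rule measurable_compose[OF measurable_snd]) (simp add: measurable_count_space_eq1)
  have Phi_meas[measurable]: "Phi \<in> borel_measurable borel"
    by (intro borel_measurable_continuous_onI continuous_feature_map[OF feature k_cont])
  have Phi_norm: "norm (Phi z) \<le> 1" for z
    using k_bound[of z] by (simp add: feature abs_square_le_1 flip: power2_norm_eq_inner)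
  have kk_meas[measurable]: "(\<lambda>z. k z z) \<in> borel_measurable borel" unfolding feature by measurable

  have L: "L_phi \<ge> 0" "L_F \<ge> 0"
    using lipschitz_on_nonneg[OF phi_lip] lipschitz_on_nonneg[OF F_lip[OF fstar_in]] by auto
  have phi_diff: "\<bar>\<phi> x - \<phi> y\<bar> \<le> L_phi * \<bar>x - y\<bar>" for x y
    using lipschitz_onD[OF phi_lip, of x y] by (simp add: dist_real_def)
  have F_diff: "\<bar>f x - f y\<bar> \<le> L_F * norm (x - y)" if "f \<in> F" for f x y
    using lipschitz_onD[OF F_lip[OF that], of x y] by (simp add: dist_real_def dist_norm)
  have phi_cont: "continuous_on UNIV \<phi>" by (rule lipschitz_on_continuous_on[OF phi_lip])
  have phi_meas[measurable]: "\<phi> \<in> borel_measurable borel" by (rule borel_measurable_continuous_onI[OF phi_cont])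
  have a_meas: "a f \<in> borel_measurable M" if "f \<in> F" for f
    unfolding a_def by (rule F_meas[OF that])
  have loss_meas[measurable]: "loss f \<in> borel_measurable M" if "f \<in> F" for f
  proof -
    note F_meas[OF that, measurable]
    show ?thesis unfolding loss_def by measurable
  qed
  have loss_bdd: "loss f pl \<in> {0..B}" if "f \<in> F" "pl \<in> space M" for f pl
    using phi_nonneg phi_B[OF that(1) M_space(3)[OF that(2)]] by (auto simp: loss_def)
  have loss_diff: "\<bar>\<phi> (- (l * x)) - \<phi> (- (l * y))\<bar> \<le> L_phi * \<bar>x - y\<bar>" if "l \<in> {-1, 1}" for l x y
    using phi_diff[of "- (l * x)" "- (l * y)"] that by (auto simp: abs_minus_commute)
  have contr: "\<bar>loss f pl - loss g pl\<bar> \<le> L_phi * \<bar>a f pl - a g pl\<bar>" if "pl \<in> space M" for f g pl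
    using loss_diff[OF M_space(3)[OF that], of "f (kme Phi (fst pl))" "g (kme Phi (fst pl))"]
    by (simp add: loss_def a_def mult.commute)
  \<comment> \<open>All embeddings lie in the unit ball, so the Lipschitz bound gives
    \<open>\<bar>f 0\<bar> + L_F\<close>. This depends on \<open>f\<close> and need not be uniform
    over \<open>F\<close>.\<close>
  have a_bdd: "\<exists>C. \<forall>pl\<in>space M. \<bar>a f pl\<bar> \<le> C" if "f \<in> F" for f
  proof (intro exI ballI)
    fix pl assume pl: "pl \<in> space M"
    interpret P: prob_space "fst pl" by (rule M_space(1)[OF pl])
    have [measurable_cong]: "sets (fst pl) = sets borel" by (rule M_space(2)[OF pl])
    have "norm (kme Phi (fst pl)) \<le> 1" by (rule P.norm_kme_le) (measurable, rule Phi_norm)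
    then have "L_F * norm (kme Phi (fst pl)) \<le> L_F * 1" using L by (intro mult_left_mono)
    then show "\<bar>a f pl\<bar> \<le> \<bar>f 0\<bar> + L_F"
      using F_diff[OF that, of "kme Phi (fst pl)" 0] by (simp add: a_def)
  qed
  have risk: "risk \<phi> M Phi f = integral\<^sup>L M (loss f)" for f by (simp add: risk_def loss_def[abs_def])
  have B_nonneg: "B \<ge> 0"
    using phi_nonneg[of "- fstar 0 * 1"] phi_B[OF fstar_in, of 1 0] by simp

  \<comment> \<open>The two-stage experiment as a Markov kernel over the bags\<close>
  have bag_space: "pls i \<in> space M" if "pls \<in> space bag" "i < n" for pls i
    using that by (auto simp: bag_PiM space_PiM)
  have fst_comp[measurable]: "(\<lambda>pls. fst (pls i)) \<in> bag \<rightarrow>\<^sub>M prob_algebra borel" if "i < n" for i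
  proof -
    have "(\<lambda>pls. pls i) \<in> bag \<rightarrow>\<^sub>M M"
      unfolding bag_PiM using that by (intro measurable_component_singleton) auto
    then show ?thesis by (rule measurable_compose[OF _ fst_M])
  qed
  have Q_kernel: "Q \<in> bag \<rightarrow>\<^sub>M prob_algebra N"
    unfolding Q_def[abs_def] N_def by (intro measurable_PiM_prob_algebra fst_comp) auto
  have K_kernel: "K \<in> bag \<rightarrow>\<^sub>M prob_algebra (bag \<Otimes>\<^sub>M N)"
    unfolding K_def[abs_def] by (rule measurable_distr_prob_space2[OF Q_kernel]) simp
  have \<Omega>_bind: "\<Omega> = bag \<bind> K"
    by (simp add: \<Omega>_def sample_space_def K_def[abs_def] Q_def[abs_def] bag_def N_def)
  have K_sets: "sets (K pls) = sets (bag \<Otimes>\<^sub>M N)" for pls by (simp add: K_def)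
  have \<Omega>_sets[measurable_cong]: "sets \<Omega> = sets (bag \<Otimes>\<^sub>M N)"
    unfolding \<Omega>_bind by (intro sets_bind K_sets bag.not_empty)
  have \<Omega>_space: "space \<Omega> = space bag \<times> space N"
    using sets_eq_imp_space_eq[OF \<Omega>_sets] by (simp add: space_pair_measure)
  interpret \<Omega>: prob_space \<Omega>
    unfolding \<Omega>_bind
    by (rule bag.prob_space_bind[OF _ measurable_prob_algebraD[OF K_kernel]])
       (use measurable_space[OF K_kernel] in \<open>auto simp: space_prob_algebra\<close>)

  \<comment> \<open>The terms of the bound and the target event\<close>
  define c where "c = ennreal (4 * L_phi) * rademacher_complexity M Phi F n"
  define t where "t = 2 * B * sqrt (ln (2 / \<delta>) / (2 * real n))"
  define ek where "ek i pls = (\<integral>z. k z z \<partial>(fst (pls i)))" for i and pls :: "nat \<Rightarrow> 'z measure \<times> real"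
  define u where "u i = sqrt (ln (2 * real n / \<delta>) / (2 * real (ns i)))" for i
  define b where "b pls = t + 4 * L_phi * L_F / real n * (\<Sum>i<n. sqrt (ek i pls / real (ns i)) + u i)" for pls
  define E where "E = {\<omega> \<in> space \<Omega>. ennreal (risk \<phi> M Phi (ftil \<omega>) - risk \<phi> M Phi fstar) \<le> c + ennreal (b (fst \<omega>))}"
  have t_nonneg: "t \<ge> 0"
    using delta B_nonneg by (auto simp: t_def intro!: mult_nonneg_nonneg ln_ge_zero)
  have u_nonneg: "u i \<ge> 0" for i
    unfolding u_def using delta n_pos by (intro real_sqrt_ge_zero divide_nonneg_nonneg ln_ge_zero) (auto simp: field_simps)
  have ek_nonneg: "ek i pls \<ge> 0" for i pls
    unfolding ek_def by (intro integral_nonneg_AE AE_I2) (simp add: feature)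
  have b_nonneg: "b pls \<ge> 0" for pls
    unfolding b_def using t_nonneg L ek_nonneg u_nonneg
    by (intro add_nonneg_nonneg mult_nonneg_nonneg divide_nonneg_nonneg sum_nonneg real_sqrt_ge_zero) auto
  have "measure \<Omega> E \<ge> 1 - \<delta>"
  proof (cases "B = 0 \<or> c = \<top>")
    \<comment> \<open>McDiarmid needs a positive range, and the complexity may be infinite.\<close>
    case True
    have "E = space \<Omega>"
    proof (cases "c = \<top>")
      case False
      then have "B = 0" using True by simp
      have "risk \<phi> M Phi f = 0" if f: "f \<in> F" for f
        unfolding risk using loss_bdd[OF f] \<open>B = 0\<close>
        by (subst Bochner_Integration.integral_cong[OF refl, of M _ "\<lambda>_. 0"]) auto
      then show ?thesis using ftil_in fstar_in by (auto simp: E_def \<Omega>_def)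
    qed (simp add: E_def)
    then show ?thesis using \<Omega>.prob_space delta by simp
  next
    case False
    then have B: "B > 0" and c_fin: "c \<noteq> \<top>" using B_nonneg by auto
    define r where "r = enn2real c"
    have r: "ennreal r = c" "r \<ge> 0" using c_fin by (auto simp: r_def less_top)

    \<comment> \<open>Uniform deviation over the bags\<close>
    obtain F0 where F0: "countable F0" "F0 \<subseteq> F"
      and F0_dense: "\<And>f. f \<in> F \<Longrightarrow> \<exists>g. (\<forall>k. g k \<in> F0) \<and> (\<forall>h. (\<lambda>k. g k h) \<longlonglongrightarrow> f h)"
      using lipschitz_class_separable[of F L_F] F_lip by blast
    define Bad where "Bad = {pls \<in> space bag. \<exists>f\<in>F0. dev f pls - dev fstar pls > r + t}"
    have Bad: "Bad \<in> sets bag" "emeasure bag Bad \<le> ennreal (\<delta> / 2)"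
    proof -
      \<comment> \<open>The complexity of the subclass \<open>F0\<close> is at most that of
        \<open>F\<close>, and the required \<open>2 * L_phi\<close> is enlarged to the
        \<open>4 * L_phi\<close> of the statement.\<close>
      have "ennreal (2 * L_phi) * (\<integral>\<^sup>+u. (SUP f\<in>F0. ennreal \<bar>(1 / n) * (\<Sum>i<n. snd u i * a f (fst u i))\<bar>)
          \<partial>(PiM {..<n} (\<lambda>_. M) \<Otimes>\<^sub>M PiM {..<n} (\<lambda>_. measure_pmf (pmf_of_set {-1, 1::real})))) \<le> c"
        unfolding c_def rademacher_complexity_def bag_space_def rademacher_signs_def rademacher_integrand_def a_def
        using L F0(2) by (intro mult_mono ennreal_leI nn_integral_mono SUP_subset_mono) auto
      moreover have t_alt: "t = 2 * B * sqrt (ln (1 / (\<delta> / 2)) / (2 * real n))" by (simp add: t_def)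
      ultimately have "Bad \<in> sets bag \<and> emeasure bag Bad \<le> ennreal (\<delta> / 2)"
        unfolding Bad_def bag_PiM dev_def t_alt r(1)[symmetric]
      proof (intro M.uniform_deviation[where L=L_phi and a=a])
        show "loss f \<in> borel_measurable M" if "f \<in> insert fstar F0" for f
          using that F0(2) fstar_in by (intro loss_meas) auto
        show "loss f pl \<in> {0..B}" if "f \<in> insert fstar F0" "pl \<in> space M" for f pl
          using that F0(2) fstar_in by (intro loss_bdd) auto
        show "a f \<in> borel_measurable M" "\<exists>C. \<forall>pl\<in>space M. \<bar>a f pl\<bar> \<le> C" if "f \<in> F0" for f
          using that F0(2) a_meas a_bdd by auto
      qed (use n_pos F0(1) L B delta r contr in auto)
      then show "Bad \<in> sets bag" "emeasure bag Bad \<le> ennreal (\<delta> / 2)" by auto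
    qed
    \<comment> \<open>\<open>ftil\<close> may lie outside \<open>F0\<close>. \<open>Bad\<close> is
      defined by a strict inequality, so its complement gives a non-strict one, which survives
      pointwise limits; the expected losses converge by dominated convergence, with the constant
      \<open>B\<close> as majorant.\<close>
    have dev_F: "dev f pls - dev fstar pls \<le> r + t" if pls: "pls \<in> space bag" "pls \<notin> Bad" and f: "f \<in> F" for f pls
    proof -
      obtain g where g: "\<And>j. g j \<in> F0" "\<And>h. (\<lambda>j. g j h) \<longlonglongrightarrow> f h" using F0_dense[OF f] by blast
      then have gF: "g j \<in> F" for j using F0(2) by auto
      have lim: "(\<lambda>j. loss (g j) pl) \<longlonglongrightarrow> loss f pl" for pl
        unfolding loss_def
        by (rule continuous_on_tendsto_compose[OF phi_cont]) (auto intro!: tendsto_intros g(2))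
      have "(\<lambda>j. integral\<^sup>L M (loss (g j))) \<longlonglongrightarrow> integral\<^sup>L M (loss f)"
        by (rule integral_dominated_convergence[where w="\<lambda>_. B"])
           (use loss_meas f gF lim loss_bdd[OF gF] in auto)
      then have "(\<lambda>j. dev (g j) pls - dev fstar pls) \<longlonglongrightarrow> dev f pls - dev fstar pls"
        unfolding dev_def by (intro tendsto_intros lim)
      then show ?thesis
        by (rule LIMSEQ_le_const2) (use pls g(1) in \<open>auto simp: Bad_def not_less\<close>)
    qed
    \<comment> \<open>The radius of \<open>kme_deviation\<close> at level
      \<open>\<delta> / (2 * real n)\<close>, with its factor 2 on the logarithmic term.\<close>
    define w where "w i pls = sqrt (ek i pls / real (ns i)) + 2 * u i" for i pls
    define Z where "Z i pls S = norm (kme_emp Phi (ns i) S - kme Phi (fst (pls i)))" for i and pls :: "nat \<Rightarrow> 'z measure \<times> real" and S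

    \<comment> \<open>Deterministic bound when the bags and all embeddings behave well\<close>
    have good: "\<omega> \<in> E" if \<omega>: "\<omega> \<in> space \<Omega>" and nb: "fst \<omega> \<notin> Bad" and close: "\<And>i. i < n \<Longrightarrow> Z i (fst \<omega>) (snd \<omega> i) < w i (fst \<omega>)" for \<omega>
    proof -
      have pls: "fst \<omega> \<in> space bag" using \<omega> by (auto simp: \<Omega>_space)
      define f where "f = ftil \<omega>"
      have f: "f \<in> F" unfolding f_def using ftil_in \<omega> by (simp add: \<Omega>_def)
      define el where "el h i = \<phi> (- snd (fst \<omega> i) * h (kme_emp Phi (ns i) (snd \<omega> i)))" for h i
      have el: "\<bar>loss h (fst \<omega> i) - el h i\<bar> \<le> L_phi * L_F * w i (fst \<omega>)" if i: "i < n" and h: "h \<in> F" for h i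
      proof -
        have "\<bar>loss h (fst \<omega> i) - el h i\<bar> \<le> L_phi * \<bar>h (kme Phi (fst (fst \<omega> i))) - h (kme_emp Phi (ns i) (snd \<omega> i))\<bar>"
          using loss_diff[OF M_space(3)[OF bag_space[OF pls i]], of "h (kme Phi (fst (fst \<omega> i)))" "h (kme_emp Phi (ns i) (snd \<omega> i))"]
          by (simp add: loss_def el_def mult.commute)
        also have "\<dots> \<le> L_phi * (L_F * Z i (fst \<omega>) (snd \<omega> i))"
          unfolding Z_def using L F_diff[OF h] by (intro mult_left_mono) (auto simp: norm_minus_commute)
        also have "\<dots> \<le> L_phi * (L_F * w i (fst \<omega>))"
          using L close[OF i] by (intro mult_left_mono) auto
        finally show ?thesis by (simp add: mult.assoc)
      qed
      have "(\<Sum>i<n. el f i) \<le> (\<Sum>i<n. el fstar i)"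
        using ftil_min[of \<omega> fstar] \<omega> fstar_in n_pos by (simp add: emp_risk_def el_def f_def \<Omega>_def divide_le_cancel)
      moreover have "(\<Sum>i<n. loss f (fst \<omega> i)) \<le> (\<Sum>i<n. el f i + L_phi * L_F * w i (fst \<omega>))"
        using el[OF _ f] by (intro sum_mono) (auto simp: abs_le_iff algebra_simps)
      moreover have "(\<Sum>i<n. el fstar i) \<le> (\<Sum>i<n. loss fstar (fst \<omega> i) + L_phi * L_F * w i (fst \<omega>))"
        using el[OF _ fstar_in] by (intro sum_mono) (auto simp: abs_le_iff algebra_simps)
      ultimately have "(\<Sum>i<n. loss f (fst \<omega> i)) - (\<Sum>i<n. loss fstar (fst \<omega> i)) \<le> 2 * (L_phi * L_F * (\<Sum>i<n. w i (fst \<omega>)))"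
        by (simp add: sum.distrib flip: sum_distrib_left)
      \<comment> \<open>The variance part of \<open>w\<close> occurs once and \<open>u i\<close>
        twice; doubling the former makes the factor common and yields the 4 of the
        statement.\<close>
      also have "\<dots> \<le> 2 * (L_phi * L_F * (\<Sum>i<n. 2 * (sqrt (ek i (fst \<omega>) / real (ns i)) + u i)))"
        using L ek_nonneg u_nonneg by (intro mult_left_mono sum_mono) (auto simp: w_def)
      also have "\<dots> = 4 * L_phi * L_F * (\<Sum>i<n. sqrt (ek i (fst \<omega>) / real (ns i)) + u i)"
        by (subst sum_distrib_left[symmetric]) simp
      finally have "(1 / real n) * ((\<Sum>i<n. loss f (fst \<omega> i)) - (\<Sum>i<n. loss fstar (fst \<omega> i)))
          \<le> (1 / real n) * (4 * L_phi * L_F * (\<Sum>i<n. sqrt (ek i (fst \<omega>) / real (ns i)) + u i))"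
        by (rule mult_left_mono) simp
      then have emp: "(1 / real n) * ((\<Sum>i<n. loss f (fst \<omega> i)) - (\<Sum>i<n. loss fstar (fst \<omega> i))) \<le> b (fst \<omega>) - t"
        by (simp add: b_def)
      have "risk \<phi> M Phi f - risk \<phi> M Phi fstar
          = (dev f (fst \<omega>) - dev fstar (fst \<omega>)) + (1 / real n) * ((\<Sum>i<n. loss f (fst \<omega> i)) - (\<Sum>i<n. loss fstar (fst \<omega> i)))"
        by (simp add: risk dev_def algebra_simps)
      also have "\<dots> \<le> r + b (fst \<omega>)"
        using dev_F[OF pls nb f] emp by linarith
      finally have "ennreal (risk \<phi> M Phi f - risk \<phi> M Phi fstar) \<le> ennreal (r + b (fst \<omega>))" by (rule ennreal_leI)
      also have "\<dots> = c + ennreal (b (fst \<omega>))"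
        using r b_nonneg by simp
      finally show ?thesis using \<omega> by (simp add: E_def f_def)
    qed

    \<comment> \<open>Measurability of the target event\<close>
    have E_sets: "E \<in> sets \<Omega>"
    proof -
      have ek_meas: "(\<lambda>\<omega>. ek i (fst \<omega>)) \<in> borel_measurable \<Omega>" if "i < n" for i
        unfolding ek_def
        by (rule measurable_compose[OF _ integral_measurable_subprob_algebra[OF kk_meas]])
           (rule measurable_prob_algebraD, rule measurable_compose[OF _ fst_comp[OF that]], measurable)
      have b_meas: "(\<lambda>\<omega>. b (fst \<omega>)) \<in> borel_measurable \<Omega>"
        unfolding b_def
        by (intro borel_measurable_add borel_measurable_times borel_measurable_sum borel_measurable_const
            measurable_compose[OF _ borel_measurable_sqrt] borel_measurable_divide ek_meas) auto
      have risk_meas: "(\<lambda>\<omega>. risk \<phi> M Phi (ftil \<omega>)) \<in> borel_measurable \<Omega>"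
        using ftil_meas by (simp add: \<Omega>_def)
      show ?thesis
        unfolding E_def
        by (intro borel_measurable_le borel_measurable_add measurable_compose[OF _ measurable_ennreal]
            borel_measurable_diff borel_measurable_const risk_meas b_meas)
    qed
    \<comment> \<open>Conditioning on the bags, the mean embeddings are constants, so only sets of points in a fixed
      fibre need to be measured.\<close>
    define V where "V i pls = {S \<in> space (PiM {..<ns i} (\<lambda>_. fst (pls i))). Z i pls S \<ge> w i pls}" for i pls
    \<comment> \<open>On bad bags the trivial bound 1 suffices. On the others \<open>good\<close>
      shows that failure forces some sample embedding out of its radius, and a union bound over the
      n bags costs n times \<open>\<delta> / (2 * real n)\<close>.\<close>
    have fiber: "emeasure (K pls) (space \<Omega> - E) \<le> indicator Bad pls + ennreal (\<delta> / 2)" if pls: "pls \<in> space bag" for pls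
    proof (cases "pls \<in> Bad")
      case True
      interpret Kp: prob_space "K pls" using measurable_space[OF K_kernel pls] by (simp add: space_prob_algebra)
      have "emeasure (K pls) (space \<Omega> - E) \<le> 1" by (rule Kp.emeasure_le_1)
      also have "\<dots> \<le> indicator Bad pls + ennreal (\<delta> / 2)" using True by simp
      finally show ?thesis .
    next
      case False
      have Pi_prob: "prob_space (fst (pls i))" and Pi_sets: "sets (fst (pls i)) = sets borel" if "i < n" for i
        using M_space[OF bag_space[OF pls that]] by auto
      have Qp: "sets (Q pls) = sets N" using measurable_space[OF Q_kernel pls] by (simp add: space_prob_algebra)
      have inner_prob: "prob_space (PiM {..<ns i} (\<lambda>_. fst (pls i)))" if "i < n" for i
        using Pi_prob[OF that] by (intro prob_space_PiM)
      have V_sets: "V i pls \<in> sets (PiM {..<ns i} (\<lambda>_. fst (pls i)))" if i: "i < n" for i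
      proof -
        have [measurable]: "Phi \<in> borel_measurable (fst (pls i))"
          using Phi_meas by (simp add: measurable_cong_sets[OF Pi_sets[OF i] refl])
        have [measurable]: "(\<lambda>S. \<Sum>j<ns i. Phi (S j)) \<in> borel_measurable (PiM {..<ns i} (\<lambda>_. fst (pls i)))"
          by (intro borel_measurable_sum) measurable
        show ?thesis unfolding V_def Z_def kme_emp_def by measurable
      qed
      have V_emeasure: "emeasure (PiM {..<ns i} (\<lambda>_. fst (pls i))) (V i pls) \<le> ennreal (\<delta> / (2 * real n))" if i: "i < n" for i
      proof -
        interpret P: prob_space "fst (pls i)" by (rule Pi_prob[OF i])
        have "\<delta> / (2 * real n) < 1" using delta n_pos by (simp add: field_simps)
        moreover have "Phi \<in> borel_measurable (fst (pls i))"
          using Phi_meas by (simp add: measurable_cong_sets[OF Pi_sets[OF i] refl])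
        ultimately show ?thesis
          using P.kme_deviation[of Phi "ns i" "\<delta> / (2 * real n)"] Phi_norm ns_pos[OF i] delta n_pos
          unfolding V_def Z_def w_def ek_def u_def feature by simp
      qed
      have comp: "(\<lambda>S. S i) \<in> Q pls \<rightarrow>\<^sub>M PiM {..<ns i} (\<lambda>_. fst (pls i))" if "i < n" for i
        unfolding Q_def using that by (intro measurable_component_singleton) auto
      have "emeasure (K pls) (space \<Omega> - E) = emeasure (Q pls) ((\<lambda>S. (pls, S)) -` (space \<Omega> - E) \<inter> space (Q pls))"
        unfolding K_def
      proof (rule emeasure_distr)
        show "(\<lambda>S. (pls, S)) \<in> Q pls \<rightarrow>\<^sub>M bag \<Otimes>\<^sub>M N"
          using pls by (simp add: measurable_cong_sets[OF Qp refl])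
        show "space \<Omega> - E \<in> sets (bag \<Otimes>\<^sub>M N)" using E_sets \<Omega>_sets by auto
      qed
      also have "\<dots> \<le> emeasure (Q pls) (\<Union>i<n. (\<lambda>S. S i) -` V i pls \<inter> space (Q pls))"
      proof (rule emeasure_mono)
        show "(\<lambda>S. (pls, S)) -` (space \<Omega> - E) \<inter> space (Q pls) \<subseteq> (\<Union>i<n. (\<lambda>S. S i) -` V i pls \<inter> space (Q pls))"
        proof
          fix S assume "S \<in> (\<lambda>S. (pls, S)) -` (space \<Omega> - E) \<inter> space (Q pls)"
          then have S: "S \<in> space (Q pls)" "(pls, S) \<in> space \<Omega>" "(pls, S) \<notin> E" by auto
          then obtain i where i: "i < n" "\<not> Z i pls (S i) < w i pls"
            using good[of "(pls, S)"] False by auto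
          then have "S i \<in> V i pls" using measurable_space[OF comp[OF i(1)] S(1)] by (simp add: V_def)
          then show "S \<in> (\<Union>i<n. (\<lambda>S. S i) -` V i pls \<inter> space (Q pls))" using i S(1) by auto
        qed
        show "(\<Union>i<n. (\<lambda>S. S i) -` V i pls \<inter> space (Q pls)) \<in> sets (Q pls)"
          by (intro sets.finite_UN measurable_sets[OF comp V_sets]) auto
      qed
      also have "\<dots> \<le> (\<Sum>i<n. emeasure (Q pls) ((\<lambda>S. S i) -` V i pls \<inter> space (Q pls)))"
        by (intro emeasure_subadditive_finite) (auto intro!: measurable_sets[OF comp V_sets])
      also have "\<dots> \<le> (\<Sum>i<n. ennreal (\<delta> / (2 * real n)))"
      proof (rule sum_mono)
        fix i assume "i \<in> {..<n}"
        then have i: "i < n" by simp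
        have "emeasure (Q pls) ((\<lambda>S. S i) -` V i pls \<inter> space (Q pls))
            = emeasure (distr (Q pls) (PiM {..<ns i} (\<lambda>_. fst (pls i))) (\<lambda>S. S i)) (V i pls)"
          by (rule emeasure_distr[symmetric, OF comp[OF i] V_sets[OF i]])
        \<comment> \<open>Under \<open>Q pls\<close> the i-th sample has the plain product law of
          points from the i-th distribution, so the one-bag concentration bound applies
          unchanged.\<close>
        also have "distr (Q pls) (PiM {..<ns i} (\<lambda>_. fst (pls i))) (\<lambda>S. S i) = PiM {..<ns i} (\<lambda>_. fst (pls i))"
          unfolding Q_def
          by (rule distr_PiM_component[where M="\<lambda>i. PiM {..<ns i} (\<lambda>_. fst (pls i))"]) (use inner_prob i in auto)
        also have "emeasure \<dots> (V i pls) \<le> ennreal (\<delta> / (2 * real n))" by (rule V_emeasure[OF i])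
        finally show "emeasure (Q pls) ((\<lambda>S. S i) -` V i pls \<inter> space (Q pls)) \<le> ennreal (\<delta> / (2 * real n))" .
      qed
      also have "\<dots> = ennreal (\<delta> / 2)"
        using n_pos delta by (subst sum_ennreal) auto
      finally show ?thesis by (simp add: add_increasing)
    qed

    \<comment> \<open>Integration of the conditional bound over the bags\<close>
    have "emeasure \<Omega> (space \<Omega> - E) = (\<integral>\<^sup>+pls. emeasure (K pls) (space \<Omega> - E) \<partial>bag)"
      unfolding \<Omega>_bind using E_sets \<Omega>_sets
      by (intro emeasure_bind[OF bag.not_empty measurable_prob_algebraD[OF K_kernel]]) (auto simp: \<Omega>_bind)
    also have "\<dots> \<le> (\<integral>\<^sup>+pls. indicator Bad pls + ennreal (\<delta> / 2) \<partial>bag)"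
      by (intro nn_integral_mono fiber)
    also have "\<dots> = emeasure bag Bad + ennreal (\<delta> / 2)"
      using Bad(1) by (subst nn_integral_add) (auto simp: bag.emeasure_space_1)
    also have "\<dots> \<le> ennreal (\<delta> / 2) + ennreal (\<delta> / 2)" by (intro add_right_mono Bad)
    also have "\<dots> = ennreal \<delta>" using delta by (simp flip: ennreal_plus)
    finally have "measure \<Omega> (space \<Omega> - E) \<le> \<delta>"
      using delta by (simp add: \<Omega>.emeasure_eq_measure)
    then show ?thesis using \<Omega>.prob_compl[OF E_sets] by simp
  qed
  then show ?thesis
    unfolding E_def b_def c_def t_def ek_def u_def \<Omega>_def .
qed

end
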